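(* Let $d\ge 1$, let $A$ be a non-singular real $d\times d$ matrix, let $\boldsymbol B(t)$, $t\ge 0$, be a $d$-dimensional Brownian motion with independent standard Brownian motion components, and let $\boldsymbol Z(t)=A\boldsymbol B(t)$, $t\ge 0$. Let $T>0$, let $\boldsymbol c:[0,\infty)\to\mathbb{R}^d$ belong to $RV_T(1/2)$, and let $\Sigma$ be the covariance matrix of $\boldsymbol Z(T)$. Set $$\mathfrak{C}(T)=\inf_{t\in[0,T)}\exp\left(-T\left(\frac{\boldsymbol c(T)-\boldsymbol c(t)}{\sqrt{T-t}}\right)^{\top}\Sigma^{-1}\left(\frac{\boldsymbol c(T)-\boldsymbol c(t)}{\sqrt{T-t}}\right)\right).$$ Then $\mathfrak{C}(T)>0$ and the following hold. (1) Let $\boldsymbol S\subset\mathbb{R}^d$ be a closed set with $\boldsymbol 0\notin \boldsymbol S$ which satisfies the cone condition with respect to the process $\boldsymbol Z$, with associated function $\varepsilon_{\boldsymbol S}$. Then for all $u>1$ $$\mathbb{P}\{\boldsymbol Z(T)-\boldsymbol c(T)\in u\boldsymbol S\}\le \mathbb{P}\{\exists\, t\in[0,T]:\ \boldsymbol Z(t)-\boldsymbol c(t)\in u\boldsymbol S\}\le \frac{2^{d/2}}{\mathfrak{C}(T)\,\varepsilon_{\boldsymbol S}(T)}\ \mathbb{P}\{\boldsymbol Z(T)-\boldsymbol c(T)\in u\boldsymbol S\}.$$ (2) In particular, for any growing function $\boldsymbol F:\mathbb{R}^d\to\mathbb{R}^d$ and any $\boldsymbol a\in\mathbb{R}^d\setminus(-\infty,0]^d$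 there exists a constant $C_T$, which does not depend on $u$, such that for all $u>1$ $$\mathbb{P}\{\exists\, t\in[0,T]:\ \boldsymbol F(\boldsymbol Z(t)-\boldsymbol c(t))>u\boldsymbol a\}\le C_T\,\mathbb{P}\{\boldsymbol F(\boldsymbol Z(T)-\boldsymbol c(T))>u\boldsymbol a\}.$$
   Context: Vectors are columns in $\mathbb{R}^d$; inequalities between vectors are component-wise. For $\boldsymbol S\subset\mathbb{R}^d$ and $u>0$, $u\boldsymbol S=\{u\boldsymbol x:\boldsymbol x\in\boldsymbol S\}$, and $\boldsymbol V-\boldsymbol x=\{\boldsymbol v-\boldsymbol x:\boldsymbol v\in\boldsymbol V\}$. Cone condition: a closed set $\boldsymbol S\subset\mathbb{R}^d$ satisfies the cone condition with respect to the process $\boldsymbol Z$ if there exists a strictly positive function $\varepsilon_{\boldsymbol S}(t)$, $t>0$, such that for every $\boldsymbol x\in\boldsymbol S$ there is a Borel set $\boldsymbol V_{\boldsymbol x}\subset\boldsymbol S$, not depending on $t$, with $\boldsymbol x\in \boldsymbol V_{\boldsymbol x}$, with $\boldsymbol V_{\boldsymbol x}-\boldsymbol x\subset C(\boldsymbol V_{\boldsymbol x}-\boldsymbol x)$ for all $C>1$, and with $\mathbb{P}\{\boldsymbol Z(t)\in\boldsymbol V_{\boldsymbol x}-\boldsymbol x\}\ge\varepsilon_{\boldsymbol S}(t)$ for all $t>0$. Any such function is called an associated function $\varepsilon_{\boldsymbol S}$. Class $RV_{t_0}(\alpha)$ (for $\alpha>0$ and $t_0\in[0,T]$): a continuous function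 $\boldsymbol c:[0,\infty)\to\mathbb{R}^d$ belongs to $RV_{t_0}(\alpha)$ if there is $M>0$ such that $|c_i(t)-c_i(t_0)|\le M|t-t_0|^{\alpha}$ for all $i\in\{1,\dots,d\}$ and all $t\in[0,T]$. Growing: $\boldsymbol F:\mathbb{R}^d\to\mathbb{R}^d$ is growing if for all $\boldsymbol x,\boldsymbol y\in\mathbb{R}^d$ with $x_i\ge y_i$ for all $i$ one has $F_i(\boldsymbol x)\ge F_i(\boldsymbol y)$ for all $i$. *)

theory Defs
  imports "HOL-Probability.Probability"
begin

(* Path regularity and the start at 0 are only required almost surely, so that
   every common convention for Brownian motion is covered. *)
locale standard_brownian_motion = prob_space M
  for M :: "'w measure" +
  fixes W :: "real \<Rightarrow> 'w \<Rightarrow> real"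
  assumes measurable: "\<And>t. 0 \<le> t \<Longrightarrow> W t \<in> borel_measurable M"
    and start: "AE \<omega> in M. W 0 \<omega> = 0"
    and indep_increments:
      "\<And>(s :: nat \<Rightarrow> real) n. 0 \<le> s 0 \<Longrightarrow> (\<And>k. k < n \<Longrightarrow> s k \<le> s (Suc k)) \<Longrightarrow>
         indep_vars (\<lambda>_. borel) (\<lambda>k \<omega>. W (s (Suc k)) \<omega> - W (s k) \<omega>) {..<n}"
    and normal_increments:
      "\<And>s t. 0 \<le> s \<Longrightarrow> s < t \<Longrightarrow>
         distributed M lborel (\<lambda>\<omega>. W t \<omega> - W s \<omega>) (normal_density 0 (sqrt (t - s)))"
    and continuous_paths: "AE \<omega> in M. continuous_on {0..} (\<lambda>t. W t \<omega>)"

(* The components are independent as processes, i.e. as random elements of the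
   product space over the time set {0..}. *)
locale vector_brownian_motion = prob_space M
  for M :: "'w measure" +
  fixes B :: "real \<Rightarrow> 'w \<Rightarrow> real ^ 'n"
  assumes components: "\<And>i. standard_brownian_motion M (\<lambda>t \<omega>. B t \<omega> $ i)"
    and indep_components:
      "indep_vars (\<lambda>_. PiM {0..} (\<lambda>_. borel)) (\<lambda>i \<omega>. \<lambda>t\<in>{0..}. B t \<omega> $ i) UNIV"

definition covariance_matrix :: "'w measure \<Rightarrow> ('w \<Rightarrow> real ^ 'n) \<Rightarrow> real ^ 'n ^ 'n" where
  "covariance_matrix M X =
     (\<chi> i j. \<integral>\<omega>. (X \<omega> $ i - (\<integral>\<omega>'. X \<omega>' $ i \<partial>M)) * (X \<omega> $ j - (\<integral>\<omega>'. X \<omega>' $ j \<partial>M)) \<partial>M)"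

(* The closed set S satisfies the cone condition with respect to Z, and e is an
   associated function. *)
definition cone_condition_with ::
  "'w measure \<Rightarrow> (real \<Rightarrow> 'w \<Rightarrow> real ^ 'n) \<Rightarrow> (real ^ 'n) set \<Rightarrow> (real \<Rightarrow> real) \<Rightarrow> bool" where
  "cone_condition_with M Z S e \<longleftrightarrow>
     closed S \<and> (\<forall>t>0. e t > 0) \<and>
     (\<forall>x\<in>S. \<exists>V. V \<in> sets borel \<and> V \<subseteq> S \<and> x \<in> V \<and>
        (\<forall>C>1. (\<lambda>v. v - x) ` V \<subseteq> (\<lambda>w. C *\<^sub>R w) ` (\<lambda>v. v - x) ` V) \<and>
        (\<forall>t>0. measure M {\<omega> \<in> space M. Z t \<omega> \<in> (\<lambda>v. v - x) ` V} \<ge> e t))"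

definition RV :: "real \<Rightarrow> real \<Rightarrow> real \<Rightarrow> (real \<Rightarrow> real ^ 'n) set" where
  "RV T t0 \<alpha> =
     {c. continuous_on {0..} c \<and>
         (\<exists>K>0. \<forall>i. \<forall>t\<in>{0..T}. \<bar>c t $ i - c t0 $ i\<bar> \<le> K * \<bar>t - t0\<bar> powr \<alpha>)}"

definition growing :: "(real ^ 'n \<Rightarrow> real ^ 'n) \<Rightarrow> bool" where
  "growing F \<longleftrightarrow> (\<forall>x y. (\<forall>i. x $ i \<ge> y $ i) \<longrightarrow> (\<forall>i. F x $ i \<ge> F y $ i))"

(* The library order < on vectors means "\<le> and not \<ge>"; here every component
   must be strictly larger. *)
definition comp_greater :: "real ^ 'n \<Rightarrow> real ^ 'n \<Rightarrow> bool" where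
  "comp_greater x y \<longleftrightarrow> (\<forall>i. x $ i > y $ i)"

end

theory Submission imports Defs
begin

text \<open>The hitting time is never used in continuous time. Fix a closed set \<open>Q\<close> and \<open>\<delta> > 0\<close>, and let the
  process \<open>X t = Z t - c t\<close> run through a finite set of times. At the first of them at which \<open>X\<close> is
  within \<open>\<delta>\<close> of \<open>Q\<close>, choose a point \<open>q \<in> Q\<close> that is \<open>\<delta>\<close>-close. The increment up to \<open>T\<close> is independent
  of the past and moves \<open>q\<close> into \<open>Q\<close> with probability at least \<open>\<kappa>\<close>, hence \<open>X T\<close> is within \<open>\<delta>\<close> of \<open>Q\<close>
  with probability at least \<open>\<kappa>\<close> times that of the discrete event. Refining the times and then
  letting \<open>\<delta>\<close> tend to 0 gives the bound for the path.

  The value of \<open>\<kappa>\<close> comes from \<open>(x - \<mu>)\<^sup>2 \<le> 2 x\<^sup>2 + 2 \<mu>\<^sup>2\<close>: the Gaussian density with mean \<open>\<mu>\<close> dominates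
  \<open>exp (- \<mu>\<^sup>2 / \<sigma>\<^sup>2) / sqrt 2\<close> times the centred density with half the variance, and shrinking only
  increases the probability of a cone.

  For a growing \<open>F\<close> the set \<open>{x. F x > u a}\<close> is an upper set, and the cone is the orthant. Such a set
  need not be Borel, but a path that meets its closure after time 0 almost surely meets its interior as
  well, so the events lie in the completion.\<close>

section \<open>Linear algebra, measurability of vectors, laws with independent components\<close>

lemma matrix_inv_mult:
  fixes A :: "real^'n^'n"
  assumes "invertible A"
  shows "A ** matrix_inv A = mat 1" "matrix_inv A ** A = mat 1"
  using someI_ex[OF assms[unfolded invertible_def]] by (auto simp: matrix_inv_def)

lemma matrix_inv_vector_mult:
  fixes A :: "real^'n^'n"
  assumes "invertible A"
  shows "A *v (matrix_inv A *v x) = x" "matrix_inv A *v (A *v x) = x"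
  using matrix_inv_mult[OF assms] by (simp_all add: matrix_vector_mul_assoc)

text \<open>Turns the quadratic form with the inverse covariance into the squared norm that the
  Gaussian comparison produces. If \<open>y\<close> solves \<open>?S *v y = w\<close>, then
  \<open>matrix_inv A *v w\<close> is \<open>t\<close> times \<open>transpose A *v y\<close>, and
  both sides are the squared norm of this vector.\<close>

lemma inner_matrix_inv_mult_transpose:
  fixes A :: "real^'n^'n"
  assumes "invertible A" "0 < t"
  shows "t * (w \<bullet> (matrix_inv (t *\<^sub>R (A ** transpose A)) *v w)) = (norm (matrix_inv A *v w))\<^sup>2"
proof -
  let ?S = "t *\<^sub>R (A ** transpose A)"
  have "invertible (A ** transpose A)" using assms by (intro invertible_mult transpose_invertible)
  then obtain C where "(A ** transpose A) ** C = mat 1" by (auto simp: invertible_def)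
  then have "?S ** ((1 / t) *\<^sub>R C) = mat 1"
    using assms by (simp add: scalar_matrix_assoc[symmetric] matrix_scalar_ac)
  then have inv: "invertible ?S" by (auto simp: invertible_right_inverse)
  define y where "y = matrix_inv ?S *v w"
  have "?S *v y = w" unfolding y_def by (rule matrix_inv_vector_mult(1)[OF inv])
  then have w: "w = A *v (t *\<^sub>R (transpose A *v y))"
    by (simp only: scaleR_matrix_vector_assoc[symmetric] matrix_vector_mul_assoc[symmetric] matrix_vector_mult_scaleR)
  then have Aw: "matrix_inv A *v w = t *\<^sub>R (transpose A *v y)"
    using matrix_inv_vector_mult(2)[OF assms(1)] by simp
  have "w \<bullet> y = (t *\<^sub>R (transpose A *v y)) \<bullet> (transpose A *v y)"
    by (subst w) (simp add: dot_lmul_matrix[symmetric] inner_commute[of _ y] vector_transpose_matrix)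
  then have "t * (w \<bullet> y) = (t *\<^sub>R (transpose A *v y)) \<bullet> (t *\<^sub>R (transpose A *v y))"
    by (simp add: algebra_simps)
  then show ?thesis unfolding Aw power2_norm_eq_inner y_def .
qed

lemma borel_measurable_vec_lambda:
  fixes f :: "'n::finite \<Rightarrow> 'a \<Rightarrow> real"
  assumes "\<And>i. f i \<in> borel_measurable M"
  shows "(\<lambda>x. \<chi> i. f i x) \<in> borel_measurable M"
proof -
  have "(\<lambda>x. (\<chi> i. f i x) \<bullet> b) \<in> borel_measurable M" if "b \<in> Basis" for b :: "real^'n"
  proof -
    from that obtain i where "b = axis i 1" by (auto simp: Basis_vec_def)
    with assms show ?thesis by (simp add: inner_axis)
  qed
  then show ?thesis
    by (subst borel_measurable_euclidean_space) auto
qed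

lemma borel_measurable_vec_nth [measurable]:
  "f \<in> borel_measurable M \<Longrightarrow> (\<lambda>x. (f x :: real^'n) $ i) \<in> borel_measurable M"
  by (rule borel_measurable_continuous_on[where f = "\<lambda>x. x $ i"]) (auto intro!: continuous_intros)

lemma borel_measurable_matrix_vector_mult [measurable]:
  "f \<in> borel_measurable M \<Longrightarrow> (\<lambda>x. (A :: real^'n^'m) *v f x) \<in> borel_measurable M"
  by (rule borel_measurable_continuous_on[where f = "\<lambda>x. A *v x"])
     (auto intro!: linear_continuous_on matrix_vector_mul_bounded_linear)

text \<open>Independence yields laws on the product space \<open>PiM\<close>, whereas densities are
  wanted on \<open>real^'n\<close>; this is the bridge. Lebesgue measure is determined by its values
  on boxes, and the coordinate map pulls a box back to a rectangle.\<close>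

lemma lborel_vec_eq_distr_PiM:
  "(lborel :: (real^'n) measure) = distr (\<Pi>\<^sub>M i\<in>UNIV. lborel) borel (\<lambda>f. \<chi> i. f i)"
proof (rule lborel_eqI)
  interpret product_sigma_finite "\<lambda>_::'n. lborel :: real measure" ..
  fix l u :: "real^'n" assume lu: "\<And>b. b \<in> Basis \<Longrightarrow> l \<bullet> b \<le> u \<bullet> b"
  have m: "(\<lambda>f. \<chi> i. f i) \<in> borel_measurable (\<Pi>\<^sub>M i\<in>(UNIV::'n set). (lborel::real measure))"
    by (rule borel_measurable_vec_lambda) simp
  have le: "l $ i \<le> u $ i" for i using lu[of "axis i 1"] by (auto simp: Basis_vec_def inner_axis)
  have "(\<lambda>f. \<chi> i. f i) -` box l u = Pi\<^sub>E UNIV (\<lambda>i. {l $ i <..< u $ i})"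
    by (auto simp: mem_box_cart PiE_UNIV_domain Pi_iff)
  then have "emeasure (distr (\<Pi>\<^sub>M i\<in>UNIV. lborel) borel (\<lambda>f. \<chi> i. f i)) (box l u)
      = emeasure (\<Pi>\<^sub>M i\<in>UNIV. lborel) (Pi\<^sub>E UNIV (\<lambda>i. {l $ i <..< u $ i}))"
    using m by (subst emeasure_distr) (auto simp: space_PiM)
  also have "\<dots> = (\<Prod>i\<in>UNIV. ennreal (u $ i - l $ i))"
    using le by (subst emeasure_PiM) auto
  also have "\<dots> = ennreal (\<Prod>i\<in>UNIV. (u - l) $ i)"
    using le by (subst prod_ennreal) auto
  also have "(\<Prod>i\<in>UNIV. (u - l) $ i) = (\<Prod>b\<in>Basis. (u - l) \<bullet> b)"
    by (simp add: Basis_vec_def UNION_singleton_eq_range prod.reindex inj_on_def axis_eq_axis inner_axis)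
  finally show "emeasure (distr (\<Pi>\<^sub>M i\<in>UNIV. lborel) borel (\<lambda>f. \<chi> i. f i)) (box l u) =
     ennreal (\<Prod>b\<in>Basis. (u - l) \<bullet> b)" .
qed simp

text \<open>A measure on a finite product is determined by rectangles, and on these the integral of
  a product of one-variable functions factorizes. That each factor is a probability density supplies
  the sigma-finiteness behind this uniqueness.\<close>

lemma PiM_density:
  fixes f :: "'n::finite \<Rightarrow> real \<Rightarrow> real"
  assumes [measurable]: "\<And>i. f i \<in> borel_measurable borel" and nn: "\<And>i x. 0 \<le> f i x"
    and p: "\<And>i. prob_space (density lborel (f i))"
  shows "(\<Pi>\<^sub>M i\<in>UNIV. density lborel (f i))
       = density (\<Pi>\<^sub>M i\<in>UNIV. lborel) (\<lambda>x. ennreal (\<Prod>i\<in>UNIV. f i (x i)))"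
proof (rule sym)
  interpret L: product_sigma_finite "\<lambda>_::'n. lborel :: real measure" ..
  interpret D: product_sigma_finite "\<lambda>i::'n. density lborel (f i)"
    using p by unfold_locales (metis prob_space_imp_sigma_finite sigma_finite_measure.sigma_finite_countable)
  show "density (\<Pi>\<^sub>M i\<in>UNIV. lborel) (\<lambda>x. ennreal (\<Prod>i\<in>UNIV. f i (x i)))
       = (\<Pi>\<^sub>M i\<in>UNIV. density lborel (f i))"
  proof (rule D.PiM_eqI)
    show "sets (density (\<Pi>\<^sub>M i\<in>UNIV. lborel) (\<lambda>x. ennreal (\<Prod>i\<in>UNIV. f i (x i)))) =
        sets (\<Pi>\<^sub>M i\<in>UNIV. density lborel (f i))"
      by (simp cong: sets_PiM_cong)
    fix A assume "\<And>i::'n. i \<in> UNIV \<Longrightarrow> A i \<in> sets (density lborel (f i))"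
    then have A[measurable]: "\<And>i. A i \<in> sets borel" by simp
    have "emeasure (density (\<Pi>\<^sub>M i\<in>UNIV. lborel) (\<lambda>x. ennreal (\<Prod>i\<in>UNIV. f i (x i)))) (Pi\<^sub>E UNIV A)
       = (\<integral>\<^sup>+ x. ennreal (\<Prod>i\<in>UNIV. f i (x i)) * indicator (Pi\<^sub>E UNIV A) x \<partial>(\<Pi>\<^sub>M i\<in>UNIV. lborel))"
      by (rule emeasure_density) (auto intro!: sets_PiM_I_finite)
    also have "\<dots> = (\<integral>\<^sup>+ x. (\<Prod>i\<in>UNIV. ennreal (f i (x i)) * indicator (A i) (x i)) \<partial>(\<Pi>\<^sub>M i\<in>UNIV. lborel))"
    proof (intro nn_integral_cong)
      fix x
      show "ennreal (\<Prod>i\<in>UNIV. f i (x i)) * indicator (Pi\<^sub>E UNIV A) x = (\<Prod>i\<in>UNIV. ennreal (f i (x i)) * indicator (A i) (x i))"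
      proof (cases "\<forall>i. x i \<in> A i")
        case True
        then show ?thesis using nn by (simp add: prod_ennreal PiE_UNIV_domain Pi_iff)
      next
        case False
        then obtain i where "x i \<notin> A i" by auto
        then have "(\<Prod>i\<in>UNIV. ennreal (f i (x i)) * indicator (A i) (x i)) = 0"
          by (intro prod_zero) (auto intro!: exI[of _ i])
        with False show ?thesis by (simp add: PiE_UNIV_domain Pi_iff)
      qed
    qed
    also have "\<dots> = (\<Prod>i\<in>UNIV. \<integral>\<^sup>+ x. ennreal (f i x) * indicator (A i) x \<partial>lborel)"
      by (rule L.product_nn_integral_prod) auto
    also have "\<dots> = (\<Prod>i\<in>UNIV. emeasure (density lborel (f i)) (A i))"
      by (simp add: emeasure_density)
    finally show "emeasure (density (\<Pi>\<^sub>M i\<in>UNIV. lborel) (\<lambda>x. ennreal (\<Prod>i\<in>UNIV. f i (x i)))) (Pi\<^sub>E UNIV A)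
       = (\<Prod>i\<in>UNIV. emeasure (density lborel (f i)) (A i))" .
  qed simp
qed

text \<open>By independence the joint law is the product of the component laws; its density comes
  from \<open>PiM_density\<close> and is then transported along the coordinate map.\<close>

lemma (in prob_space) distr_vec_indep_density:
  fixes X :: "'n::finite \<Rightarrow> 'a \<Rightarrow> real" and f :: "'n \<Rightarrow> real \<Rightarrow> real"
  assumes ind: "indep_vars (\<lambda>_. borel) X UNIV"
    and d: "\<And>i. distributed M lborel (X i) (f i)"
    and f[measurable]: "\<And>i. f i \<in> borel_measurable borel" and nn: "\<And>i x. 0 \<le> f i x"
  shows "distr M borel (\<lambda>\<omega>. \<chi> i. X i \<omega>) = density lborel (\<lambda>x. ennreal (\<Prod>i\<in>UNIV. f i (x $ i)))"
proof -
  have X[measurable]: "X i \<in> borel_measurable M" for i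
    using d[of i] by (simp add: distributed_def)
  have dX: "distr M borel (X i) = density lborel (f i)" for i
    using d[of i] by (simp add: distributed_def cong: distr_cong)
  have pr: "prob_space (density lborel (f i))" for i
    unfolding dX[symmetric] by (rule prob_space_distr) simp
  have v: "(\<lambda>f. \<chi> i. f i) \<in> borel_measurable (\<Pi>\<^sub>M i\<in>(UNIV::'n set). (borel::real measure))"
    by (rule borel_measurable_vec_lambda) simp
  have v': "(\<lambda>f. \<chi> i. f i) \<in> borel_measurable (\<Pi>\<^sub>M i\<in>(UNIV::'n set). (lborel::real measure))"
    by (rule borel_measurable_vec_lambda) simp
  have "distr M borel (\<lambda>\<omega>. \<chi> i. X i \<omega>)
      = distr (distr M (\<Pi>\<^sub>M i\<in>UNIV. borel) (\<lambda>\<omega>. \<lambda>i\<in>UNIV. X i \<omega>)) borel (\<lambda>f. \<chi> i. f i)"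
    using v by (subst distr_distr) (auto simp: comp_def restrict_UNIV intro!: measurable_PiM_single')
  also have "distr M (\<Pi>\<^sub>M i\<in>UNIV. borel) (\<lambda>\<omega>. \<lambda>i\<in>UNIV. X i \<omega>) = (\<Pi>\<^sub>M i\<in>UNIV. distr M borel (X i))"
    using ind by (subst (asm) indep_vars_iff_distr_eq_PiM') auto
  also have "\<dots> = density (\<Pi>\<^sub>M i\<in>UNIV. lborel) (\<lambda>x. ennreal (\<Prod>i\<in>UNIV. f i (x i)))"
    unfolding dX by (rule PiM_density) (use nn pr in auto)
  also have "distr \<dots> borel (\<lambda>f. \<chi> i. f i)
      = density (distr (\<Pi>\<^sub>M i\<in>UNIV. lborel) borel (\<lambda>f. \<chi> i. f i)) (\<lambda>x. ennreal (\<Prod>i\<in>UNIV. f i (x $ i)))"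
    using v' by (subst density_distr) auto
  also have "\<dots> = density lborel (\<lambda>x. ennreal (\<Prod>i\<in>UNIV. f i (x $ i)))"
    by (simp add: lborel_vec_eq_distr_PiM)
  finally show ?thesis .
qed

section \<open>Comparison of Gaussian laws\<close>

text \<open>The density with standard deviation \<open>\<sigma> / sqrt 2\<close> has the exponent
  \<open>- x\<^sup>2 / \<sigma>\<^sup>2\<close>, which is what the elementary inequality leaves once
  the term in \<open>\<mu>\<close> is split off. Its normalising factor is larger by
  \<open>sqrt 2\<close>, hence the division by \<open>sqrt 2\<close>.\<close>

lemma normal_density_shift_ge:
  assumes "0 < \<sigma>"
  shows "normal_density \<mu> \<sigma> x \<ge> exp (- \<mu>\<^sup>2 / \<sigma>\<^sup>2) / sqrt 2 * normal_density 0 (\<sigma> / sqrt 2) x"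
proof -
  have "x\<^sup>2 / \<sigma>\<^sup>2 + \<mu>\<^sup>2 / \<sigma>\<^sup>2 \<ge> (x - \<mu>)\<^sup>2 / (2 * \<sigma>\<^sup>2)"
  proof -
    \<comment> \<open>The right side minus the left side is the square of
      \<open>x + \<mu>\<close>.\<close>
    have "(x - \<mu>)\<^sup>2 \<le> 2 * x\<^sup>2 + 2 * \<mu>\<^sup>2"
      using zero_le_power2[of "x + \<mu>"] by (simp add: power2_eq_square algebra_simps)
    then have "(x - \<mu>)\<^sup>2 / (2 * \<sigma>\<^sup>2) \<le> (2 * x\<^sup>2 + 2 * \<mu>\<^sup>2) / (2 * \<sigma>\<^sup>2)"
      using assms by (intro divide_right_mono) auto
    also have "\<dots> = x\<^sup>2 / \<sigma>\<^sup>2 + \<mu>\<^sup>2 / \<sigma>\<^sup>2" using assms by (simp add: field_simps)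
    finally show ?thesis .
  qed
  then have e: "exp (- \<mu>\<^sup>2 / \<sigma>\<^sup>2) * exp (- x\<^sup>2 / \<sigma>\<^sup>2) \<le> exp (- (x - \<mu>)\<^sup>2 / (2 * \<sigma>\<^sup>2))"
    by (simp add: exp_add[symmetric])
  have s: "sqrt (2 * pi * (\<sigma> / sqrt 2)\<^sup>2) = sqrt (2 * pi * \<sigma>\<^sup>2) / sqrt 2"
    by (simp add: power_divide real_sqrt_mult real_sqrt_divide)
  have "exp (- \<mu>\<^sup>2 / \<sigma>\<^sup>2) / sqrt 2 * normal_density 0 (\<sigma> / sqrt 2) x
     = 1 / sqrt (2 * pi * \<sigma>\<^sup>2) * (exp (- \<mu>\<^sup>2 / \<sigma>\<^sup>2) * exp (- x\<^sup>2 / \<sigma>\<^sup>2))"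
    unfolding normal_density_def s using assms by (simp add: power_divide)
  also have "\<dots> \<le> 1 / sqrt (2 * pi * \<sigma>\<^sup>2) * exp (- (x - \<mu>)\<^sup>2 / (2 * \<sigma>\<^sup>2))"
    by (intro mult_left_mono e) auto
  finally show ?thesis by (simp add: normal_density_def)
qed

text \<open>Multiply the one-dimensional bound over the coordinates and integrate over
  \<open>G\<close>: the exponents add up to the squared norm of \<open>\<mu>\<close>, and the
  factors \<open>1 / sqrt 2\<close> give the power of 2.\<close>

lemma (in prob_space) normal_shift_prob_ge:
  fixes X Y :: "'n::finite \<Rightarrow> 'a \<Rightarrow> real"
  assumes \<sigma>: "0 < \<sigma>"
    and X: "indep_vars (\<lambda>_. borel) X UNIV" "\<And>i. distributed M lborel (X i) (normal_density (\<mu> $ i) \<sigma>)"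
    and Y: "indep_vars (\<lambda>_. borel) Y UNIV" "\<And>i. distributed M lborel (Y i) (normal_density 0 (\<sigma> / sqrt 2))"
    and G: "G \<in> sets borel"
  shows "prob {\<omega>\<in>space M. (\<chi> i. X i \<omega>) \<in> G}
      \<ge> exp (- (norm \<mu>)\<^sup>2 / \<sigma>\<^sup>2) / 2 powr (real CARD('n) / 2) * prob {\<omega>\<in>space M. (\<chi> i. Y i \<omega>) \<in> G}"
proof -
  let ?c = "exp (- (norm \<mu>)\<^sup>2 / \<sigma>\<^sup>2) / 2 powr (real CARD('n) / 2)"
  let ?f = "\<lambda>x::real^'n. \<Prod>i\<in>UNIV. normal_density (\<mu> $ i) \<sigma> (x $ i)"
  let ?g = "\<lambda>x::real^'n. \<Prod>i\<in>UNIV. normal_density 0 (\<sigma> / sqrt 2) (x $ i)"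
  have Xm[measurable]: "X i \<in> borel_measurable M" and Ym[measurable]: "Y i \<in> borel_measurable M" for i
    using X(2)[of i] Y(2)[of i] by (simp_all add: distributed_def)
  have Xv[measurable]: "(\<lambda>\<omega>. \<chi> i. X i \<omega>) \<in> borel_measurable M"
    and Yv[measurable]: "(\<lambda>\<omega>. \<chi> i. Y i \<omega>) \<in> borel_measurable M"
    by (intro borel_measurable_vec_lambda; simp)+
  have dX: "distr M borel (\<lambda>\<omega>. \<chi> i. X i \<omega>) = density lborel (\<lambda>x. ennreal (?f x))"
    by (rule distr_vec_indep_density) (use X in auto)
  have dY: "distr M borel (\<lambda>\<omega>. \<chi> i. Y i \<omega>) = density lborel (\<lambda>x. ennreal (?g x))"
    by (rule distr_vec_indep_density) (use Y in auto)
  have c: "?c = (\<Prod>i\<in>UNIV. exp (- (\<mu> $ i)\<^sup>2 / \<sigma>\<^sup>2) / sqrt 2)"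
  proof -
    have "(norm \<mu>)\<^sup>2 = (\<Sum>i\<in>UNIV. (\<mu> $ i)\<^sup>2)"
      by (simp add: norm_vec_def L2_set_def sum_nonneg)
    then have "exp (- (norm \<mu>)\<^sup>2 / \<sigma>\<^sup>2) = (\<Prod>i\<in>UNIV. exp (- (\<mu> $ i)\<^sup>2 / \<sigma>\<^sup>2))"
      by (simp add: exp_sum[symmetric] sum_divide_distrib sum_negf)
    moreover have "2 powr (real CARD('n) / 2) = sqrt 2 ^ CARD('n)"
      by (simp add: powr_half_sqrt[symmetric] powr_powr[symmetric] powr_realpow[symmetric] powr_powr)
    ultimately show ?thesis by (simp add: prod_dividef)
  qed
  have fg: "?c * ?g x \<le> ?f x" for x
    unfolding c prod.distrib[symmetric]
    by (intro prod_mono) (use normal_density_shift_ge[OF \<sigma>] in auto)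
  have "ennreal ?c * emeasure (distr M borel (\<lambda>\<omega>. \<chi> i. Y i \<omega>)) G
      = (\<integral>\<^sup>+x. ennreal ?c * (ennreal (?g x) * indicator G x) \<partial>lborel)"
    unfolding dY using G by (subst emeasure_density) (auto intro!: nn_integral_cmult[symmetric])
  also have "\<dots> \<le> (\<integral>\<^sup>+x. ennreal (?f x) * indicator G x \<partial>lborel)"
  proof (intro nn_integral_mono)
    fix x
    have "ennreal ?c * ennreal (?g x) \<le> ennreal (?f x)"
      using ennreal_leI[OF fg[of x]] by (subst ennreal_mult[symmetric]) (auto intro!: prod_nonneg)
    then show "ennreal ?c * (ennreal (?g x) * indicator G x) \<le> ennreal (?f x) * indicator G x"
      by (auto split: split_indicator)
  qed
  also have "\<dots> = emeasure (distr M borel (\<lambda>\<omega>. \<chi> i. X i \<omega>)) G"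
    unfolding dX using G by (subst emeasure_density) auto
  finally have "ennreal ?c * emeasure M {\<omega>\<in>space M. (\<chi> i. Y i \<omega>) \<in> G} \<le> emeasure M {\<omega>\<in>space M. (\<chi> i. X i \<omega>) \<in> G}"
    using G by (simp add: emeasure_distr vimage_def Int_def conj_commute)
  then show ?thesis
    by (simp add: emeasure_eq_measure ennreal_mult[symmetric])
qed

text \<open>The translates by \<open>w / (k + 1)\<close> of a bounded piece of \<open>N\<close> are disjoint, equally large and stay in
  one ball.\<close>

lemma null_sets_disjoint_translates:
  fixes N :: "'a::euclidean_space set"
  assumes N[measurable]: "N \<in> sets borel"
    and disj: "\<And>x s. x \<in> N \<Longrightarrow> 0 < s \<Longrightarrow> x + s *\<^sub>R w \<notin> N"
  shows "N \<in> null_sets lborel"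
proof -
  have bounded: "emeasure lborel (N \<inter> cball 0 (real m)) = 0" for m
  proof -
    define A where "A = N \<inter> cball 0 (real m)"
    have A[measurable]: "A \<in> sets borel" by (simp add: A_def)
    \<comment> \<open>The scalars \<open>1 / (k + 1)\<close> are distinct, so two translates differ
      by a nonzero multiple of \<open>w\<close>; they are at most 1, so all translates stay in the
      ball of radius \<open>m + norm w\<close>.\<close>
    define t where "t k = (1 / real (Suc k)) *\<^sub>R w" for k
    define A' where "A' k = (\<lambda>x. t k + x) ` A" for k
    have A'_alt: "A' k = (\<lambda>x. (- t k) + x) -` A" for k
      by (force simp: A'_def)
    have A'm[measurable]: "A' k \<in> sets borel" for k
      unfolding A'_alt using measurable_sets[of "(+) (- t k)" borel borel A] by simp
    have eq: "emeasure lborel (A' k) = emeasure lborel A" for k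
      unfolding A'_alt
      by (subst lborel_distr_plus[of "- t k", symmetric], subst emeasure_distr) auto
    have no: "\<not> (x \<in> A' i \<and> x \<in> A' j)" if "i < j" for i j x
    proof
      assume x: "x \<in> A' i \<and> x \<in> A' j"
      then obtain y z where yz: "y \<in> N" "z \<in> N" "x = t i + y" "x = t j + z" by (auto simp: A'_def A_def)
      then have "z = y + (1 / real (Suc i) - 1 / real (Suc j)) *\<^sub>R w"
        by (auto simp: t_def scaleR_left_diff_distrib algebra_simps)
      moreover have "1 / real (Suc i) - 1 / real (Suc j) > 0" using that by (simp add: frac_less2)
      ultimately show False using disj yz by blast
    qed
    have "disjoint_family A'"
      unfolding disjoint_family_on_def using no by (metis disjoint_iff nat_neq_iff)
    have sub: "A' k \<subseteq> cball 0 (real m + norm w)" for k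
    proof
      fix x assume "x \<in> A' k"
      then obtain y where y: "norm y \<le> real m" "x = t k + y" by (auto simp: A'_def A_def)
      have "norm (t k) \<le> norm w" by (auto simp: t_def divide_le_eq mult_left_le_one_le field_simps)
      with y norm_triangle_ineq[of "t k" y] show "x \<in> cball 0 (real m + norm w)" by simp
    qed
    have fin: "emeasure lborel (cball 0 (real m + norm w) :: 'a set) < \<infinity>"
      by (rule emeasure_compact_finite) simp
    \<comment> \<open>For every \<open>k\<close>, \<open>k\<close> disjoint copies of
      \<open>A\<close> fit into one ball of finite measure; the Archimedean property then forces
      \<open>A\<close> to have measure 0.\<close>
    have bnd: "of_nat k * emeasure lborel A \<le> emeasure lborel (cball 0 (real m + norm w) :: 'a set)" for k
    proof -
      have "of_nat k * emeasure lborel A = (\<Sum>i<k. emeasure lborel (A' i))" by (simp add: eq)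
      also have "\<dots> = emeasure lborel (\<Union>i<k. A' i)"
        using \<open>disjoint_family A'\<close> by (intro sum_emeasure) (auto simp: disjoint_family_on_def)
      also have "\<dots> \<le> emeasure lborel (cball 0 (real m + norm w) :: 'a set)"
        using sub by (intro emeasure_mono) auto
      finally show ?thesis .
    qed
    have "emeasure lborel A = 0"
    proof (rule ccontr)
      assume n0: "emeasure lborel A \<noteq> 0"
      have "emeasure lborel A < \<infinity>" using bnd[of 1] fin by (simp add: le_less_trans)
      then obtain a where a: "emeasure lborel A = ennreal a" "a > 0" 
        using n0 by (cases "emeasure lborel A") (auto simp: less_le)
      obtain b where b: "emeasure lborel (cball 0 (real m + norm w) :: 'a set) = ennreal b" "b \<ge> 0"
        using fin by (cases "emeasure lborel (cball 0 (real m + norm w) :: 'a set)") auto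
      obtain k where "real k * a > b" using a(2) reals_Archimedean3 by blast
      moreover have "real k * a \<le> b"
        using bnd[of k] a b by (simp add: ennreal_of_nat_eq_real_of_nat ennreal_mult[symmetric])
      ultimately show False by simp
    qed
    then show ?thesis by (simp add: A_def)
  qed
  have "(\<Union>m. N \<inter> cball 0 (real m)) \<in> null_sets lborel"
    by (intro null_sets_UN) (auto intro!: null_setsI bounded)
  also have "(\<Union>m. N \<inter> cball 0 (real m)) = N"
    using real_arch_simple by auto
  finally show ?thesis .
qed

section \<open>Independence of past and future\<close>

text \<open>The sigma-algebra generated by a process is already generated by preimages of cylinder
  sets. These are stable under intersection, so independence can be checked on them.\<close>

lemma sigma_sets_vimage_PiM:
  assumes "X \<in> \<Omega> \<rightarrow> space (PiM I N)"
  shows "sigma_sets \<Omega> {X -` A \<inter> \<Omega> |A. A \<in> sets (PiM I N)}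
       = sigma_sets \<Omega> {X -` A \<inter> \<Omega> |A. A \<in> prod_algebra I N}"
proof -
  have "sigma_sets \<Omega> {X -` A \<inter> \<Omega> |A. A \<in> sets (PiM I N)}
      = sigma_sets \<Omega> (sigma_sets \<Omega> {X -` A \<inter> \<Omega> |A. A \<in> prod_algebra I N})"
    using assms unfolding sets_PiM space_PiM
    by (subst sigma_sets_vimage_commute) auto
  also have "\<dots> = sigma_sets \<Omega> {X -` A \<inter> \<Omega> |A. A \<in> prod_algebra I N}"
    by (rule sigma_sets_sigma_sets_eq) auto
  finally show ?thesis .
qed

lemma Int_stable_vimage:
  assumes "Int_stable G"
  shows "Int_stable {X -` A \<inter> \<Omega> |A. A \<in> G}"
proof (rule Int_stableI)
  fix a b assume "a \<in> {X -` A \<inter> \<Omega> |A. A \<in> G}" "b \<in> {X -` A \<inter> \<Omega> |A. A \<in> G}"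
  then obtain A B where AB: "a = X -` A \<inter> \<Omega>" "b = X -` B \<inter> \<Omega>" "A \<in> G" "B \<in> G" by auto
  then have "a \<inter> b = X -` (A \<inter> B) \<inter> \<Omega>" by auto
  with Int_stableD[OF assms AB(3,4)] show "a \<inter> b \<in> {X -` A \<inter> \<Omega> |A. A \<in> G}" by blast
qed

text \<open>A cylinder constrains finitely many coordinates only, so \<open>fin\<close> gives the
  product rule for pairs of cylinder events. As these events form intersection-stable generators,
  independence extends to the whole families, also over uncountable index sets.\<close>

lemma (in prob_space) indep_var_PiM_finite:
  assumes X: "\<And>i. i \<in> I \<Longrightarrow> X i \<in> measurable M (N i)"
    and Y: "\<And>k. k \<in> K \<Longrightarrow> Y k \<in> measurable M (N' k)"
    and fin: "\<And>J L. finite J \<Longrightarrow> J \<subseteq> I \<Longrightarrow> finite L \<Longrightarrow> L \<subseteq> K \<Longrightarrow>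
      indep_var (PiM J N) (\<lambda>\<omega>. \<lambda>i\<in>J. X i \<omega>) (PiM L N') (\<lambda>\<omega>. \<lambda>k\<in>L. Y k \<omega>)"
  shows "indep_var (PiM I N) (\<lambda>\<omega>. \<lambda>i\<in>I. X i \<omega>) (PiM K N') (\<lambda>\<omega>. \<lambda>k\<in>K. Y k \<omega>)"
proof -
  let ?X = "\<lambda>\<omega>. \<lambda>i\<in>I. X i \<omega>" and ?Y = "\<lambda>\<omega>. \<lambda>k\<in>K. Y k \<omega>"
  have mX[measurable]: "?X \<in> measurable M (PiM I N)" by (intro measurable_restrict X)
  have mY[measurable]: "?Y \<in> measurable M (PiM K N')" by (intro measurable_restrict Y)
  \<comment> \<open>Pulling a cylinder back along the whole family amounts to pulling its base back
    along the finite subfamily; by measurability the remaining coordinates lie in their spaces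
    anyway.\<close>
  have pre: "(\<lambda>\<omega>. \<lambda>i\<in>I'. Z i \<omega>) -` prod_emb I' N'' J (Pi\<^sub>E J E) \<inter> space M
      = (\<lambda>\<omega>. \<lambda>i\<in>J. Z i \<omega>) -` Pi\<^sub>E J E \<inter> space M"
    if J: "J \<subseteq> I'" and Z: "\<And>i. i \<in> I' \<Longrightarrow> Z i \<in> measurable M (N'' i)"
    for I' :: "'j set" and J E and Z :: "'j \<Rightarrow> 'a \<Rightarrow> 'd" and N''
    using J Z[THEN measurable_space]
    by (auto simp: prod_emb_def PiE_iff restrict_restrict Int_absorb1)
  have "indep_set {?X -` A \<inter> space M |A. A \<in> prod_algebra I N} {?Y -` A \<inter> space M |A. A \<in> prod_algebra K N'}"
    unfolding indep_sets2_eq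
  proof (intro conjI ballI)
    show "{?X -` A \<inter> space M |A. A \<in> prod_algebra I N} \<subseteq> events"
      using measurable_sets[OF mX] by (auto simp: sets_PiM)
    show "{?Y -` A \<inter> space M |A. A \<in> prod_algebra K N'} \<subseteq> events"
      using measurable_sets[OF mY] by (auto simp: sets_PiM)
    fix a b assume "a \<in> {?X -` A \<inter> space M |A. A \<in> prod_algebra I N}" "b \<in> {?Y -` A \<inter> space M |A. A \<in> prod_algebra K N'}"
    then obtain A C where a: "a = ?X -` A \<inter> space M" "A \<in> prod_algebra I N"
      and b: "b = ?Y -` C \<inter> space M" "C \<in> prod_algebra K N'" by auto
    obtain J E where J: "A = prod_emb I N J (Pi\<^sub>E J E)" "finite J" "J \<subseteq> I" "\<And>i. i \<in> J \<Longrightarrow> E i \<in> sets (N i)"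
      using prod_algebraE[OF a(2)] by metis
    obtain L D where L: "C = prod_emb K N' L (Pi\<^sub>E L D)" "finite L" "L \<subseteq> K" "\<And>i. i \<in> L \<Longrightarrow> D i \<in> sets (N' i)"
      using prod_algebraE[OF b(2)] by metis
    have a': "a = (\<lambda>\<omega>. \<lambda>i\<in>J. X i \<omega>) -` Pi\<^sub>E J E \<inter> space M"
      unfolding a J(1) using J X by (intro pre) auto
    have b': "b = (\<lambda>\<omega>. \<lambda>i\<in>L. Y i \<omega>) -` Pi\<^sub>E L D \<inter> space M"
      unfolding b L(1) using L Y by (intro pre) auto
    have "prob ((\<lambda>\<omega>. (\<lambda>i\<in>J. X i \<omega>, \<lambda>k\<in>L. Y k \<omega>)) -` (Pi\<^sub>E J E \<times> Pi\<^sub>E L D) \<inter> space M) = prob a * prob b"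
      unfolding a' b' using J L by (intro indep_varD[OF fin] sets_PiM_I_finite) auto
    also have "(\<lambda>\<omega>. (\<lambda>i\<in>J. X i \<omega>, \<lambda>k\<in>L. Y k \<omega>)) -` (Pi\<^sub>E J E \<times> Pi\<^sub>E L D) \<inter> space M = a \<inter> b"
      unfolding a' b' by auto
    finally show "prob (a \<inter> b) = prob a * prob b" .
  qed
  then have "indep_set (sigma_sets (space M) {?X -` A \<inter> space M |A. A \<in> prod_algebra I N})
     (sigma_sets (space M) {?Y -` A \<inter> space M |A. A \<in> prod_algebra K N'})"
    by (rule indep_set_sigma_sets) (intro Int_stable_vimage Int_stable_prod_algebra)+
  then show ?thesis
    using mX mY measurable_space[OF mX] measurable_space[OF mY]
    unfolding indep_var_eq by (subst (1 2) sigma_sets_vimage_PiM) auto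
qed

text \<open>For fixed \<open>i\<close> the constraints on all \<open>Y i k\<close> form a single
  constraint \<open>C i\<close> on \<open>X i\<close>. Independence over \<open>i\<close> factorizes
  the probability first, and \<open>ind'\<close> then splits every factor over
  \<open>k\<close>.\<close>

lemma (in prob_space) indep_vars_Times:
  assumes fin: "finite I" "finite K"
    and ind: "indep_vars N X I"
    and ind': "\<And>i. i \<in> I \<Longrightarrow> indep_vars (N' i) (Y i) K"
    and f: "\<And>i k. i \<in> I \<Longrightarrow> k \<in> K \<Longrightarrow> f i k \<in> measurable (N i) (N' i k)"
    and Y: "\<And>i k \<omega>. i \<in> I \<Longrightarrow> k \<in> K \<Longrightarrow> \<omega> \<in> space M \<Longrightarrow> Y i k \<omega> = f i k (X i \<omega>)"
  shows "indep_vars (\<lambda>(i, k). N' i k) (\<lambda>(i, k). Y i k) (I \<times> K)"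
proof (cases "I \<times> K = {}")
  case True
  then show ?thesis by (auto simp: indep_vars_def indep_sets_def)
next
  case False
  then have ne: "I \<noteq> {}" "K \<noteq> {}" by auto
  have X: "X i \<in> measurable M (N i)" if "i \<in> I" for i
    using ind that by (simp add: indep_vars_def)
  have mY: "Y i k \<in> measurable M (N' i k)" if "i \<in> I" "k \<in> K" for i k
    using ind'[OF that(1)] that(2) by (simp add: indep_vars_def)
  show ?thesis
  proof (subst indep_vars_finite[where E = "\<lambda>(i, k). sets (N' i k)"])
    show "I \<times> K \<noteq> {}" "finite (I \<times> K)" using False fin by auto
    show "\<forall>A\<in>\<Pi> p\<in>I \<times> K. (case p of (i, k) \<Rightarrow> sets (N' i k)).
      prob (\<Inter>j\<in>I \<times> K. (case j of (i, k) \<Rightarrow> Y i k) -` A j \<inter> space M) =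
      (\<Prod>j\<in>I \<times> K. prob ((case j of (i, k) \<Rightarrow> Y i k) -` A j \<inter> space M))"
    proof
      fix A assume "A \<in> (\<Pi> p\<in>I \<times> K. (case p of (i, k) \<Rightarrow> sets (N' i k)))"
      then have A: "A (i, k) \<in> sets (N' i k)" if "i \<in> I" "k \<in> K" for i k using that by auto
      define C where "C i = {x \<in> space (N i). \<forall>k\<in>K. f i k x \<in> A (i, k)}" for i
      have C: "C i \<in> sets (N i)" if "i \<in> I" for i
      proof -
        have "C i = (\<Inter>k\<in>K. f i k -` A (i, k) \<inter> space (N i))" using ne by (auto simp: C_def)
        also have "\<dots> \<in> sets (N i)"
          using fin ne that A f by (intro sets.finite_INT measurable_sets) auto
        finally show ?thesis .
      qed
      have CX: "X i -` C i \<inter> space M = (\<Inter>k\<in>K. Y i k -` A (i, k) \<inter> space M)" if "i \<in> I" for i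
        using that ne Y[OF that] measurable_space[OF X[OF that]] by (auto simp: C_def)
      have "(\<Inter>j\<in>I \<times> K. (case j of (i, k) \<Rightarrow> Y i k) -` A j \<inter> space M) = (\<Inter>i\<in>I. \<Inter>k\<in>K. Y i k -` A (i, k) \<inter> space M)"
        by auto
      also have "\<dots> = (\<Inter>i\<in>I. X i -` C i \<inter> space M)" using CX by auto
      also have "prob \<dots> = (\<Prod>i\<in>I. prob (X i -` C i \<inter> space M))"
        using ne fin C by (intro indep_varsD_finite[OF ind]) auto
      also have "\<dots> = (\<Prod>i\<in>I. \<Prod>k\<in>K. prob (Y i k -` A (i, k) \<inter> space M))"
      proof (rule prod.cong)
        fix i assume i: "i \<in> I"
        show "prob (X i -` C i \<inter> space M) = (\<Prod>k\<in>K. prob (Y i k -` A (i, k) \<inter> space M))"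
          unfolding CX[OF i] using ne fin A i by (intro indep_varsD_finite[OF ind'[OF i]]) auto
      qed simp
      also have "\<dots> = (\<Prod>j\<in>I \<times> K. prob ((case j of (i, k) \<Rightarrow> Y i k) -` A j \<inter> space M))"
        by (subst prod.cartesian_product) (auto intro!: prod.cong)
      finally show "prob (\<Inter>j\<in>I \<times> K. (case j of (i, k) \<Rightarrow> Y i k) -` A j \<inter> space M) =
        (\<Prod>j\<in>I \<times> K. prob ((case j of (i, k) \<Rightarrow> Y i k) -` A j \<inter> space M))" .
    qed
  qed (use mY in \<open>auto simp: sets.sigma_sets_eq Int_stable_def dest: sets.sets_into_space\<close>)
qed

context standard_brownian_motion
begin

text \<open>Sort all times. Increments from 0 up to past times are sums of consecutive increments
  before the position of \<open>s\<close>; increments from \<open>s\<close> are sums of those after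
  it. Disjoint blocks of independent variables are independent.\<close>

lemma indep_past_future_finite:
  assumes s: "0 \<le> s" and J: "finite J" "J \<subseteq> {0..s}" and L: "finite L" "L \<subseteq> {s..}"
  shows "indep_var (PiM J (\<lambda>_. borel)) (\<lambda>\<omega>. \<lambda>r\<in>J. W r \<omega> - W 0 \<omega>)
                   (PiM L (\<lambda>_. borel)) (\<lambda>\<omega>. \<lambda>r\<in>L. W r \<omega> - W s \<omega>)"
proof -
  \<comment> \<open>The base points 0 and \<open>s\<close> are included, so that every increment in
    question runs between two of the sorted times.\<close>
  define F where "F = {0, s} \<union> J \<union> L"
  define xs where "xs = sorted_list_of_set F"
  define t where "t k = xs ! k" for k
  have fF: "finite F" using J L by (simp add: F_def)
  have xs: "set xs = F" "sorted xs" "distinct xs" using fF by (auto simp: xs_def)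
  have ne: "xs \<noteq> []" using xs(1) by (auto simp: F_def)
  have F0: "0 \<le> r" if "r \<in> F" for r using that s J L by (auto simp: F_def)
  have ex: "\<exists>k<length xs. t k = r" if "r \<in> F" for r
    using that xs(1) by (auto simp: t_def in_set_conv_nth)
  define idx where "idx r = (SOME k. k < length xs \<and> t k = r)" for r
  have idx: "idx r < length xs" "t (idx r) = r" if "r \<in> F" for r
    using someI_ex[OF ex[OF that]] by (auto simp: idx_def)
  \<comment> \<open>\<open>n\<close> counts the consecutive increments, one fewer than the times;
    \<open>m\<close> is the position of \<open>s\<close>, so the indices below \<open>m\<close>
    belong to the past.\<close>
  define n where "n = length xs - 1"
  define m where "m = idx s"
  have inF: "0 \<in> F" "s \<in> F" "J \<subseteq> F" "L \<subseteq> F" by (auto simp: F_def)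
  have mono: "t i < t j \<longleftrightarrow> i < j" if "i < length xs" "j < length xs" for i j
  proof -
    have "sorted_wrt (<) xs" using xs by (simp add: strict_sorted_iff)
    then show ?thesis
      using that sorted_wrt_nth_less[of "(<)" xs i j] sorted_wrt_nth_less[of "(<)" xs j i]
      by (cases i j rule: linorder_cases) (auto simp: t_def)
  qed
  have t0: "t 0 = 0"
  proof -
    have "\<not> t 0 < 0" using F0 xs(1) ne by (metis t_def length_greater_0_conv nth_mem not_less)
    moreover have "\<not> 0 < t 0" using mono[of "idx 0" 0] idx[OF inF(1)] ne by auto
    ultimately show ?thesis by simp
  qed
  define \<xi> where "\<xi> k \<omega> = W (t (Suc k)) \<omega> - W (t k) \<omega>" for k \<omega>
  have ind: "indep_vars (\<lambda>_. borel) \<xi> {..<n}"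
    unfolding \<xi>_def
  proof (rule indep_increments)
    show "0 \<le> t 0" by (simp add: t0)
    fix k assume "k < n"
    then have "Suc k < length xs" by (simp add: n_def)
    then show "t k \<le> t (Suc k)" using mono[of k "Suc k"] by simp
  qed
  have mn: "m \<le> n" using idx(1)[OF inF(2)] by (simp add: m_def n_def)
  have J_idx: "idx r \<le> m" if "r \<in> J" for r
  proof -
    have "r \<in> F" "\<not> t m < r" using that inF J idx(2)[OF inF(2)] by (auto simp: m_def)
    then show ?thesis using mono[of m "idx r"] idx[of r] idx(1)[OF inF(2)] by (simp add: m_def)
  qed
  have L_idx: "m \<le> idx r" "idx r \<le> n" if "r \<in> L" for r
  proof -
    have "r \<in> F" "\<not> r < t m" using that inF L idx(2)[OF inF(2)] by (auto simp: m_def)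
    then show "m \<le> idx r" "idx r \<le> n" using mono[of "idx r" m] idx[of r] idx(1)[OF inF(2)] by (auto simp: m_def n_def)
  qed
  let ?f = "\<lambda>x. \<lambda>r\<in>J. \<Sum>k<idx r. x k :: real" and ?g = "\<lambda>x. \<lambda>r\<in>L. \<Sum>k=m..<idx r. x k :: real"
  have "indep_var (PiM {..<m} (\<lambda>_. borel)) (\<lambda>\<omega>. restrict (\<lambda>k. \<xi> k \<omega>) {..<m})
       (PiM {m..<n} (\<lambda>_. borel)) (\<lambda>\<omega>. restrict (\<lambda>k. \<xi> k \<omega>) {m..<n})"
    using mn by (intro indep_var_restrict[OF ind]) auto
  then have "indep_var (PiM J (\<lambda>_. borel)) (?f \<circ> (\<lambda>\<omega>. restrict (\<lambda>k. \<xi> k \<omega>) {..<m}))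
       (PiM L (\<lambda>_. borel)) (?g \<circ> (\<lambda>\<omega>. restrict (\<lambda>k. \<xi> k \<omega>) {m..<n}))"
  proof (rule indep_var_compose)
    show "?f \<in> measurable (PiM {..<m} (\<lambda>_. borel)) (PiM J (\<lambda>_. borel))"
    proof (intro measurable_restrict borel_measurable_sum)
      fix r k assume "r \<in> J" "k \<in> {..<idx r}"
      then show "(\<lambda>x. x k) \<in> borel_measurable (PiM {..<m} (\<lambda>_. borel))"
        using J_idx[of r] by (intro measurable_component_singleton) auto
    qed
    show "?g \<in> measurable (PiM {m..<n} (\<lambda>_. borel)) (PiM L (\<lambda>_. borel))"
    proof (intro measurable_restrict borel_measurable_sum)
      fix r k assume "r \<in> L" "k \<in> {m..<idx r}"
      then show "(\<lambda>x. x k) \<in> borel_measurable (PiM {m..<n} (\<lambda>_. borel))"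
        using L_idx[of r] by (intro measurable_component_singleton) auto
    qed
  qed
  also have "?f \<circ> (\<lambda>\<omega>. restrict (\<lambda>k. \<xi> k \<omega>) {..<m}) = (\<lambda>\<omega>. \<lambda>r\<in>J. W r \<omega> - W 0 \<omega>)"
  proof (rule ext, unfold comp_def, rule restrict_ext)
    fix \<omega> r assume r: "r \<in> J"
    have "(\<Sum>k<idx r. restrict (\<lambda>k. \<xi> k \<omega>) {..<m} k) = (\<Sum>k<idx r. W (t (Suc k)) \<omega> - W (t k) \<omega>)"
      using J_idx[OF r] by (intro sum.cong) (auto simp: \<xi>_def)
    also have "\<dots> = W r \<omega> - W 0 \<omega>"
      using r inF idx[of r] t0 by (subst sum_lessThan_telescope) auto
    finally show "(\<Sum>k<idx r. restrict (\<lambda>k. \<xi> k \<omega>) {..<m} k) = W r \<omega> - W 0 \<omega>" .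
  qed
  also have "?g \<circ> (\<lambda>\<omega>. restrict (\<lambda>k. \<xi> k \<omega>) {m..<n}) = (\<lambda>\<omega>. \<lambda>r\<in>L. W r \<omega> - W s \<omega>)"
  proof (rule ext, unfold comp_def, rule restrict_ext)
    fix \<omega> r assume r: "r \<in> L"
    have "(\<Sum>k=m..<idx r. restrict (\<lambda>k. \<xi> k \<omega>) {m..<n} k) = (\<Sum>k=m..<idx r. W (t (Suc k)) \<omega> - W (t k) \<omega>)"
      using L_idx[OF r] by (intro sum.cong) (auto simp: \<xi>_def)
    also have "\<dots> = W (t (idx r)) \<omega> - W (t m) \<omega>"
      using L_idx[OF r] by (intro sum_Suc_diff')
    also have "\<dots> = W r \<omega> - W s \<omega>"
      using r inF idx(2)[of r] idx(2)[of s] by (auto simp: m_def)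
    finally show "(\<Sum>k=m..<idx r. restrict (\<lambda>k. \<xi> k \<omega>) {m..<n} k) = W r \<omega> - W s \<omega>" .
  qed
  finally show ?thesis .
qed

lemma indep_past_future:
  assumes s: "0 \<le> s"
  shows "indep_var (PiM {0..s} (\<lambda>_. borel)) (\<lambda>\<omega>. \<lambda>r\<in>{0..s}. W r \<omega> - W 0 \<omega>)
                   (PiM {s..} (\<lambda>_. borel)) (\<lambda>\<omega>. \<lambda>r\<in>{s..}. W r \<omega> - W s \<omega>)"
proof (rule indep_var_PiM_finite)
  show "(\<lambda>\<omega>. W r \<omega> - W 0 \<omega>) \<in> borel_measurable M" if "r \<in> {0..s}" for r
    using that by (intro borel_measurable_diff measurable) auto
  show "(\<lambda>\<omega>. W r \<omega> - W s \<omega>) \<in> borel_measurable M" if "r \<in> {s..}" for r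
    using that s by (intro borel_measurable_diff measurable) auto
qed (rule indep_past_future_finite[OF s])

end

context vector_brownian_motion
begin

lemma component_measurable: "0 \<le> t \<Longrightarrow> (\<lambda>\<omega>. B t \<omega> $ i) \<in> borel_measurable M"
  using standard_brownian_motion.measurable[OF components] .

lemma B_measurable: "0 \<le> t \<Longrightarrow> B t \<in> borel_measurable M"
  using borel_measurable_vec_lambda[of "\<lambda>i \<omega>. B t \<omega> $ i" M] component_measurable[of t]
  by simp

text \<open>Index the pieces by a component \<open>i\<close> and a Boolean that says past or future.
  Components are independent of each other, and within one component past and future are
  independent, so all pairs are jointly independent. Grouping the pairs by the Boolean and
  reassembling vectors gives the claim.\<close>

lemma indep_past_future:
  assumes s: "0 \<le> s"
  shows "indep_var (PiM {0..s} (\<lambda>_. borel)) (\<lambda>\<omega>. \<lambda>r\<in>{0..s}. B r \<omega> - B 0 \<omega>)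
                   (PiM {s..} (\<lambda>_. borel)) (\<lambda>\<omega>. \<lambda>r\<in>{s..}. B r \<omega> - B s \<omega>)"
proof -
  let ?P = "PiM {0..s} (\<lambda>_. borel :: real measure)" and ?F = "PiM {s..} (\<lambda>_. borel :: real measure)"
  \<comment> \<open>\<open>True\<close> selects the past and \<open>False\<close> the future; both
    are functions of one whole component path, as \<open>indep_vars_Times\<close> requires.\<close>
  let ?f = "case_bool (\<lambda>x. \<lambda>r\<in>{0..s}. x r - x 0 :: real) (\<lambda>x. \<lambda>r\<in>{s..}. x r - x s)"
  let ?Y = "\<lambda>i. case_bool (\<lambda>\<omega>. \<lambda>r\<in>{0..s}. B r \<omega> $ i - B 0 \<omega> $ i) (\<lambda>\<omega>. \<lambda>r\<in>{s..}. B r \<omega> $ i - B s \<omega> $ i)"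
  have "indep_vars (\<lambda>(i, k). case_bool ?P ?F k) (\<lambda>(i, k). ?Y i k) (UNIV \<times> UNIV)"
  proof (rule indep_vars_Times[OF _ _ indep_components])
    show "indep_vars (case_bool ?P ?F) (?Y i) UNIV" for i
      using standard_brownian_motion.indep_past_future[OF components s, of i]
      by (simp add: indep_var_def)
    show "?f k \<in> measurable (PiM {0..} (\<lambda>_. borel)) (case_bool ?P ?F k)" for k
      using s by (cases k) (auto intro!: measurable_restrict borel_measurable_diff measurable_component_singleton)
    show "?Y i k \<omega> = ?f k (\<lambda>t\<in>{0..}. B t \<omega> $ i)" for i k \<omega>
      using s by (cases k) (auto intro!: restrict_ext)
  qed auto
  then have "indep_var (PiM (UNIV \<times> {True}) (\<lambda>(i, k). case_bool ?P ?F k)) (\<lambda>\<omega>. restrict (\<lambda>p. (case p of (i, k) \<Rightarrow> ?Y i k) \<omega>) (UNIV \<times> {True}))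
      (PiM (UNIV \<times> {False}) (\<lambda>(i, k). case_bool ?P ?F k)) (\<lambda>\<omega>. restrict (\<lambda>p. (case p of (i, k) \<Rightarrow> ?Y i k) \<omega>) (UNIV \<times> {False}))"
    by (rule indep_var_restrict) auto
  then have "indep_var (PiM {0..s} (\<lambda>_. borel)) ((\<lambda>f. \<lambda>r\<in>{0..s}. \<chi> i. f (i, True) r) \<circ> (\<lambda>\<omega>. restrict (\<lambda>p. (case p of (i, k) \<Rightarrow> ?Y i k) \<omega>) (UNIV \<times> {True})))
      (PiM {s..} (\<lambda>_. borel)) ((\<lambda>f. \<lambda>r\<in>{s..}. \<chi> i. f (i, False) r) \<circ> (\<lambda>\<omega>. restrict (\<lambda>p. (case p of (i, k) \<Rightarrow> ?Y i k) \<omega>) (UNIV \<times> {False})))"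
  proof (rule indep_var_compose)
    show "(\<lambda>f. \<lambda>r\<in>{0..s}. \<chi> i. f (i, True) r) \<in> measurable (PiM (UNIV \<times> {True}) (\<lambda>(i, k). case_bool ?P ?F k)) (PiM {0..s} (\<lambda>_. borel))"
    proof (intro measurable_restrict borel_measurable_vec_lambda)
      fix r i assume "r \<in> {0..s}"
      then have "(\<lambda>x. x r) \<in> borel_measurable ?P" by (rule measurable_component_singleton)
      moreover have "(\<lambda>f. f (i, True)) \<in> measurable (PiM (UNIV \<times> {True}) (\<lambda>(i, k). case_bool ?P ?F k)) ?P"
        using measurable_component_singleton[of "(i, True)" "UNIV \<times> {True}" "\<lambda>(i, k). case_bool ?P ?F k"] by simp
      ultimately show "(\<lambda>f. f (i, True) r) \<in> borel_measurable (PiM (UNIV \<times> {True}) (\<lambda>(i, k). case_bool ?P ?F k))"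
        using measurable_compose by blast
    qed
    show "(\<lambda>f. \<lambda>r\<in>{s..}. \<chi> i. f (i, False) r) \<in> measurable (PiM (UNIV \<times> {False}) (\<lambda>(i, k). case_bool ?P ?F k)) (PiM {s..} (\<lambda>_. borel))"
    proof (intro measurable_restrict borel_measurable_vec_lambda)
      fix r i assume "r \<in> {s..}"
      then have "(\<lambda>x. x r) \<in> borel_measurable ?F" by (rule measurable_component_singleton)
      moreover have "(\<lambda>f. f (i, False)) \<in> measurable (PiM (UNIV \<times> {False}) (\<lambda>(i, k). case_bool ?P ?F k)) ?F"
        using measurable_component_singleton[of "(i, False)" "UNIV \<times> {False}" "\<lambda>(i, k). case_bool ?P ?F k"] by simp
      ultimately show "(\<lambda>f. f (i, False) r) \<in> borel_measurable (PiM (UNIV \<times> {False}) (\<lambda>(i, k). case_bool ?P ?F k))"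
        using measurable_compose by blast
    qed
  qed
  also have "(\<lambda>f. \<lambda>r\<in>{0..s}. \<chi> i. f (i, True) r) \<circ> (\<lambda>\<omega>. restrict (\<lambda>p. (case p of (i, k) \<Rightarrow> ?Y i k) \<omega>) (UNIV \<times> {True}))
     = (\<lambda>\<omega>. \<lambda>r\<in>{0..s}. B r \<omega> - B 0 \<omega>)"
    by (auto simp: fun_eq_iff vec_eq_iff restrict_def)
  also have "(\<lambda>f. \<lambda>r\<in>{s..}. \<chi> i. f (i, False) r) \<circ> (\<lambda>\<omega>. restrict (\<lambda>p. (case p of (i, k) \<Rightarrow> ?Y i k) \<omega>) (UNIV \<times> {False}))
     = (\<lambda>\<omega>. \<lambda>r\<in>{s..}. B r \<omega> - B s \<omega>)"
    by (auto simp: fun_eq_iff vec_eq_iff restrict_def)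
  finally show ?thesis .
qed

lemma indep_increment_components:
  assumes "0 \<le> s" "0 \<le> t"
  shows "indep_vars (\<lambda>_. borel) (\<lambda>i \<omega>. (B t \<omega> - B s \<omega>) $ i) UNIV"
proof -
  have "indep_vars (\<lambda>_. borel) (\<lambda>i \<omega>. (\<lambda>x. x t - x s) (\<lambda>t\<in>{0..}. B t \<omega> $ i)) UNIV"
    using assms by (intro indep_vars_compose2[OF indep_components])
      (auto intro!: borel_measurable_diff measurable_component_singleton)
  then show ?thesis using assms by simp
qed

lemma increment_component_distributed:
  "0 \<le> s \<Longrightarrow> s < t \<Longrightarrow> distributed M lborel (\<lambda>\<omega>. (B t \<omega> - B s \<omega>) $ i) (normal_density 0 (sqrt (t - s)))"
  using standard_brownian_motion.normal_increments[OF components] by simp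

lemma AE_start: "AE \<omega> in M. B 0 \<omega> = 0"
proof -
  have "AE \<omega> in M. \<forall>i. B 0 \<omega> $ i = 0"
    using standard_brownian_motion.start[OF components] by (intro AE_finite_allI[of UNIV, simplified]) auto
  then show ?thesis by (simp add: vec_eq_iff)
qed

lemma AE_continuous: "AE \<omega> in M. continuous_on {0..} (\<lambda>t. B t \<omega>)"
proof -
  have "AE \<omega> in M. \<forall>i. continuous_on {0..} (\<lambda>t. B t \<omega> $ i)"
    using standard_brownian_motion.continuous_paths[OF components] by (intro AE_finite_allI[of UNIV, simplified]) auto
  then show ?thesis
  proof eventually_elim
    case (elim \<omega>)
    then have "continuous_on {0..} (\<lambda>t. \<chi> i. B t \<omega> $ i)" by (intro continuous_on_vec_lambda) blast
    then show ?case by simp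
  qed
qed

end

section \<open>Hitting a closed set\<close>

text \<open>Describes a hit through times in \<open>D\<close> only, which makes it measurable for
  countable \<open>D\<close>. Conversely to the approximation by continuity, the distance to
  \<open>Q\<close> attains its minimum on the compact interval; the minimum is below every
  \<open>1 / (m + 1)\<close>, hence 0, and \<open>Q\<close> is closed.\<close>

lemma hits_closed_iff:
  fixes f :: "real \<Rightarrow> 'a::metric_space"
  assumes f: "continuous_on {a..b} f" and Q: "closed Q" "Q \<noteq> {}"
    and D: "D \<subseteq> {a..b}" "{a..b} \<subseteq> closure D"
  shows "(\<exists>t\<in>{a..b}. f t \<in> Q) \<longleftrightarrow> (\<forall>m. \<exists>t\<in>D. infdist (f t) Q < 1 / real (Suc m))"
proof
  assume "\<exists>t\<in>{a..b}. f t \<in> Q"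
  then obtain t where t: "t \<in> {a..b}" "f t \<in> Q" by auto
  show "\<forall>m. \<exists>t\<in>D. infdist (f t) Q < 1 / real (Suc m)"
  proof
    fix m
    obtain d where d: "d > 0" "\<And>s. s \<in> {a..b} \<Longrightarrow> dist s t < d \<Longrightarrow> dist (f s) (f t) < 1 / real (Suc m)"
      using f t(1) unfolding continuous_on_iff by (metis of_nat_0_less_iff zero_less_Suc zero_less_divide_1_iff)
    obtain s where s: "s \<in> D" "dist s t < d"
      using D t(1) d(1) by (meson closure_approachable subsetD)
    have "infdist (f s) Q \<le> dist (f s) (f t)" using t(2) by (rule infdist_le)
    also have "\<dots> < 1 / real (Suc m)" using d(2) s D by auto
    finally show "\<exists>t\<in>D. infdist (f t) Q < 1 / real (Suc m)" using s by auto
  qed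
next
  assume *: "\<forall>m. \<exists>t\<in>D. infdist (f t) Q < 1 / real (Suc m)"
  then have "{a..b} \<noteq> {}" using D by blast
  moreover have "continuous_on {a..b} (\<lambda>t. infdist (f t) Q)"
    using f by (intro continuous_intros)
  ultimately obtain t where t: "t \<in> {a..b}" "\<And>s. s \<in> {a..b} \<Longrightarrow> infdist (f t) Q \<le> infdist (f s) Q"
    using continuous_attains_inf[of "{a..b}"] by (metis compact_Icc)
  have "infdist (f t) Q < 1 / real (Suc m)" for m
    using * t(2) D by (meson le_less_trans subsetD)
  then have "\<not> infdist (f t) Q > 0"
    by (metis nat_approx_posE less_asym)
  then have "infdist (f t) Q = 0" using infdist_nonneg[of "f t" Q] by simp
  then show "\<exists>t\<in>{a..b}. f t \<in> Q" using t(1) Q in_closed_iff_infdist_zero by blast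
qed

text \<open>The times spent in an open set are relatively open in the interval, so if there are any,
  a dense set of times contains one.\<close>

lemma hits_open_iff:
  fixes f :: "real \<Rightarrow> 'a::topological_space"
  assumes f: "continuous_on {a..b} f" and U: "open U"
    and D: "D \<subseteq> {a..b}" "{a..b} \<subseteq> closure D"
  shows "(\<exists>t\<in>{a..b}. f t \<in> U) \<longleftrightarrow> (\<exists>t\<in>D. f t \<in> U)"
proof
  assume "\<exists>t\<in>{a..b}. f t \<in> U"
  then obtain t where t: "t \<in> {a..b}" "f t \<in> U" by auto
  obtain V where V: "open V" "V \<inter> {a..b} = f -` U \<inter> {a..b}"
    using f U unfolding continuous_on_open_invariant by metis
  then have "t \<in> V" "t \<in> closure D" using t D by auto
  then have "V \<inter> D \<noteq> {}" using V(1) open_Int_closure_eq_empty by blast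
  then show "\<exists>t\<in>D. f t \<in> U" using V D by blast
qed (use D in auto)

lemma borel_measurable_infdist [measurable (raw)]:
  fixes f :: "'a \<Rightarrow> 'b::metric_space"
  assumes "f \<in> borel_measurable M"
  shows "(\<lambda>x. infdist (f x) Q) \<in> borel_measurable M"
  by (rule borel_measurable_continuous_on[OF _ assms]) (intro continuous_intros)

lemma infdist_lessE:
  assumes "Q \<noteq> {}" "infdist x Q < \<delta>"
  obtains q where "q \<in> Q" "dist x q < \<delta>"
proof -
  have "bdd_below (dist x ` Q)" by (auto intro!: bdd_belowI[of _ 0])
  then have "\<exists>q\<in>Q. dist x q < \<delta>"
    using assms by (simp add: infdist_def cINF_less_iff)
  then show ?thesis using that by blast
qed

text \<open>In the completion every subset of a null set is measurable, so an event inherits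
  membership and measure from an almost surely equal one. This covers hitting events over an
  interval of times and the exchange of \<open>Z t - c t\<close> for \<open>X t\<close>.\<close>

lemma completion_AE_cong:
  assumes P': "{\<omega>\<in>space M. P' \<omega>} \<in> sets (completion M)" and ae: "AE \<omega> in M. P \<omega> \<longleftrightarrow> P' \<omega>"
  shows "{\<omega>\<in>space M. P \<omega>} \<in> sets (completion M)"
    and "measure (completion M) {\<omega>\<in>space M. P \<omega>} = measure (completion M) {\<omega>\<in>space M. P' \<omega>}"
proof -
  have ae': "AE \<omega> in completion M. P \<omega> \<longleftrightarrow> P' \<omega>" using ae by (rule AE_completion)
  show 1: "{\<omega>\<in>space M. P \<omega>} \<in> sets (completion M)"
    by (rule completion.in_sets_AE[where A = "{\<omega>\<in>space M. P' \<omega>}"]) (use ae' P' in \<open>auto elim: eventually_mono\<close>)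
  show "measure (completion M) {\<omega>\<in>space M. P \<omega>} = measure (completion M) {\<omega>\<in>space M. P' \<omega>}"
    by (rule measure_eq_AE) (use ae' P' 1 in \<open>auto elim: eventually_mono\<close>)
qed

section \<open>First-passage bound at discrete times and its passage to the limit\<close>

locale drifted_brownian_motion = vector_brownian_motion M B
  for M :: "'w measure" and B :: "real \<Rightarrow> 'w \<Rightarrow> real ^ 'n" +
  fixes A :: "real ^ 'n ^ 'n" and c :: "real \<Rightarrow> real ^ 'n" and T :: real
  assumes inv_A: "invertible A" and T_pos: "0 < T" and c_cont: "continuous_on {0..} c"
begin

text \<open>The start at 0 holds only almost surely. With \<open>B t - B 0\<close> in place of
  \<open>B t\<close>, \<open>X t\<close> is for every outcome a function of the past path that
  occurs in \<open>indep_past_future\<close>.\<close>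

definition X :: "real \<Rightarrow> 'w \<Rightarrow> real ^ 'n" where
  "X t \<omega> = A *v (B t \<omega> - B 0 \<omega>) - c t"

lemma X_measurable: "0 \<le> t \<Longrightarrow> X t \<in> borel_measurable M"
  unfolding X_def using B_measurable[of t] B_measurable[of 0] by measurable

lemma AE_X_continuous: "AE \<omega> in M. continuous_on {0..T} (\<lambda>t. X t \<omega>)"
  using AE_continuous
proof eventually_elim
  case (elim \<omega>)
  then have "continuous_on {0..T} (\<lambda>t. B t \<omega>)" "continuous_on {0..T} c"
    using c_cont by (auto intro: continuous_on_subset)
  then show ?case unfolding X_def
    by (intro continuous_intros linear_continuous_on_compose[where g = "(*v) A"]) auto
qed

lemma AE_eq_X: "AE \<omega> in M. \<forall>t. A *v B t \<omega> - c t = X t \<omega>"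
  using AE_start by eventually_elim (simp add: X_def)

text \<open>Given the past, the current position is within \<open>\<delta>\<close> of some \<open>q \<in> Q\<close>; the increment that
  carries \<open>q\<close> into \<open>Q\<close> carries the current position into the \<open>\<delta>\<close>-neighbourhood of \<open>Q\<close>.\<close>

lemma reach_neighbourhood_step:
  assumes s: "0 \<le> s" "s \<le> T" and Q: "Q \<noteq> {}" "closed Q"
    and \<kappa>: "0 \<le> \<kappa>" "\<And>x. x \<in> Q \<Longrightarrow> \<kappa> \<le> prob {\<omega>\<in>space M. x + (A *v (B T \<omega> - B s \<omega>) - (c T - c s)) \<in> Q}"
    and D[measurable]: "D \<in> sets (PiM {0..s} (\<lambda>_. borel))"
    and near: "\<And>p. p \<in> D \<Longrightarrow> infdist (A *v p s - c s) Q < \<delta>"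
  shows "\<kappa> * prob {\<omega>\<in>space M. (\<lambda>r\<in>{0..s}. B r \<omega> - B 0 \<omega>) \<in> D}
      \<le> prob {\<omega>\<in>space M. (\<lambda>r\<in>{0..s}. B r \<omega> - B 0 \<omega>) \<in> D \<and> infdist (X T \<omega>) Q < \<delta>}"
proof -
  let ?S = "PiM {0..s} (\<lambda>_. borel :: (real^'n) measure)" and ?F = "PiM {s..} (\<lambda>_. borel :: (real^'n) measure)"
  let ?p = "\<lambda>\<omega>. \<lambda>r\<in>{0..s}. B r \<omega> - B 0 \<omega>" and ?f = "\<lambda>\<omega>. \<lambda>r\<in>{s..}. B r \<omega> - B s \<omega>"
  note ind = indep_past_future[OF s(1)]
  have p[measurable]: "?p \<in> measurable M ?S" and f[measurable]: "?f \<in> measurable M ?F"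
    using indep_var_rv1[OF ind] indep_var_rv2[OF ind] by auto
  interpret S: prob_space "distr M ?S ?p" by (rule prob_space_distr) simp
  interpret F: prob_space "distr M ?F ?f" by (rule prob_space_distr) simp
  \<comment> \<open>The target event in terms of the independent pair of past and future: the
    position at \<open>s\<close> plus the later increment is \<open>X T\<close>.\<close>
  define C where "C = {y\<in>space (?S \<Otimes>\<^sub>M ?F). fst y \<in> D \<and>
    infdist (A *v fst y s - c s + (A *v snd y T - (c T - c s))) Q < \<delta>}"
  have [measurable]: "(\<lambda>p. p s) \<in> borel_measurable ?S" "(\<lambda>p. p T) \<in> borel_measurable ?F"
    using s by (auto intro!: measurable_component_singleton)
  have C[measurable]: "C \<in> sets (?S \<Otimes>\<^sub>M ?F)" unfolding C_def by measurable
  have sec: "ennreal \<kappa> * indicator D p \<le> emeasure (distr M ?F ?f) (Pair p -` C)" if "p \<in> space ?S" for p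
  proof (cases "p \<in> D")
    case True
    \<comment> \<open>The point \<open>q\<close> is chosen for each fixed past \<open>p\<close>.
      Only the section measure, which is measurable in \<open>p\<close>, enters the integral below,
      so no measurable selection is involved.\<close>
    obtain q where q: "q \<in> Q" "dist (A *v p s - c s) q < \<delta>"
      using infdist_lessE[OF Q(1) near[OF True]] by metis
    have "{\<omega>\<in>space M. q + (A *v (B T \<omega> - B s \<omega>) - (c T - c s)) \<in> Q} \<subseteq> ?f -` (Pair p -` C) \<inter> space M"
    proof
      fix \<omega> assume \<omega>: "\<omega> \<in> {\<omega>\<in>space M. q + (A *v (B T \<omega> - B s \<omega>) - (c T - c s)) \<in> Q}"
      have "infdist (A *v p s - c s + (A *v ?f \<omega> T - (c T - c s))) Q
        \<le> dist (A *v p s - c s + (A *v ?f \<omega> T - (c T - c s))) (q + (A *v (B T \<omega> - B s \<omega>) - (c T - c s)))"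
        using \<omega> by (intro infdist_le) auto
      \<comment> \<open>The same increment is added to both points, so their distance does not
        change.\<close>
      also have "\<dots> < \<delta>" using q s by (simp add: dist_norm algebra_simps)
      finally show "\<omega> \<in> ?f -` (Pair p -` C) \<inter> space M"
        using \<omega> True that measurable_space[OF f] by (auto simp: C_def space_pair_measure)
    qed
    then have "prob {\<omega>\<in>space M. q + (A *v (B T \<omega> - B s \<omega>) - (c T - c s)) \<in> Q}
       \<le> prob (?f -` (Pair p -` C) \<inter> space M)"
      using that by (intro finite_measure_mono measurable_sets[OF f]) (auto intro: sets_Pair1)
    with \<kappa>(2)[OF q(1)] have "ennreal \<kappa> \<le> emeasure M (?f -` (Pair p -` C) \<inter> space M)"
      by (simp add: emeasure_eq_measure ennreal_leI)
    with True show ?thesis by (subst emeasure_distr) (auto intro: sets_Pair1)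
  qed auto
  have "ennreal (\<kappa> * prob {\<omega>\<in>space M. ?p \<omega> \<in> D}) = ennreal \<kappa> * emeasure (distr M ?S ?p) D"
    using \<kappa>(1) by (simp add: emeasure_distr emeasure_eq_measure ennreal_mult vimage_def Int_def conj_commute)
  also have "\<dots> = (\<integral>\<^sup>+p. ennreal \<kappa> * indicator D p \<partial>distr M ?S ?p)"
    by (simp add: nn_integral_cmult_indicator)
  also have "\<dots> \<le> (\<integral>\<^sup>+p. emeasure (distr M ?F ?f) (Pair p -` C) \<partial>distr M ?S ?p)"
    by (intro nn_integral_mono) (use sec in auto)
  also have "\<dots> = emeasure (distr M ?S ?p \<Otimes>\<^sub>M distr M ?F ?f) C"
    by (subst F.emeasure_pair_measure_alt) (auto cong: sets_pair_measure_cong)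
  also have "distr M ?S ?p \<Otimes>\<^sub>M distr M ?F ?f = distr M (?S \<Otimes>\<^sub>M ?F) (\<lambda>\<omega>. (?p \<omega>, ?f \<omega>))"
    using ind unfolding indep_var_distribution_eq by simp
  also have "emeasure \<dots> C = emeasure M ((\<lambda>\<omega>. (?p \<omega>, ?f \<omega>)) -` C \<inter> space M)"
    by (subst emeasure_distr) auto
  also have "(\<lambda>\<omega>. (?p \<omega>, ?f \<omega>)) -` C \<inter> space M = {\<omega>\<in>space M. ?p \<omega> \<in> D \<and> infdist (X T \<omega>) Q < \<delta>}"
  proof -
    have "A *v ?p \<omega> s - c s + (A *v ?f \<omega> T - (c T - c s)) = X T \<omega>" for \<omega>
      using s by (simp add: X_def matrix_vector_mult_diff_distrib algebra_simps)
    then show ?thesis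
      using measurable_space[OF p] measurable_space[OF f]
      by (auto simp: C_def space_pair_measure simp del: restrict_apply)
  qed
  finally show ?thesis
    unfolding emeasure_eq_measure ennreal_le_iff[OF measure_nonneg] .
qed

text \<open>\<open>E t\<close> says that \<open>t\<close> is the first time in \<open>F\<close> at
  which \<open>X\<close> is \<open>\<delta>\<close>-close to \<open>Q\<close>. It depends only on
  the past up to \<open>t\<close>, so \<open>reach_neighbourhood_step\<close> applies; the events
  are disjoint and \<open>\<kappa>\<close> is common to all, so the inequalities can be
  summed.\<close>

lemma reach_neighbourhood_finite:
  assumes F: "finite F" "F \<subseteq> {0..T}" and Q: "Q \<noteq> {}" "closed Q"
    and \<kappa>: "0 \<le> \<kappa>" "\<And>x s. x \<in> Q \<Longrightarrow> 0 \<le> s \<Longrightarrow> s \<le> T \<Longrightarrow>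
      \<kappa> \<le> prob {\<omega>\<in>space M. x + (A *v (B T \<omega> - B s \<omega>) - (c T - c s)) \<in> Q}"
  shows "\<kappa> * prob {\<omega>\<in>space M. \<exists>t\<in>F. infdist (X t \<omega>) Q < \<delta>} \<le> prob {\<omega>\<in>space M. infdist (X T \<omega>) Q < \<delta>}"
proof -
  define E where "E t = {\<omega>\<in>space M. infdist (X t \<omega>) Q < \<delta> \<and> (\<forall>s\<in>F. s < t \<longrightarrow> \<not> infdist (X s \<omega>) Q < \<delta>)}" for t
  define G where "G = {\<omega>\<in>space M. infdist (X T \<omega>) Q < \<delta>}"
  have Xm[measurable]: "X t \<in> borel_measurable M" if "t \<in> F" for t
    using that F by (intro X_measurable) auto
  have Gm[measurable]: "G \<in> sets M" 
  proof -
    have [measurable]: "X T \<in> borel_measurable M" using T_pos by (intro X_measurable) auto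
    show ?thesis unfolding G_def by measurable
  qed
  have Em[measurable]: "E t \<in> sets M" if "t \<in> F" for t
  proof -
    have [measurable]: "Measurable.pred M (\<lambda>\<omega>. \<forall>s\<in>F. s < t \<longrightarrow> \<not> infdist (X s \<omega>) Q < \<delta>)"
      using F by (intro pred_intros_finite) measurable
    show ?thesis unfolding E_def using that by measurable
  qed
  have step: "\<kappa> * prob (E t) \<le> prob (E t \<inter> G)" if t: "t \<in> F" for t
  proof -
    have t0: "0 \<le> t" "t \<le> T" using t F by auto
    let ?S = "PiM {0..t} (\<lambda>_. borel :: (real^'n) measure)"
    \<comment> \<open>The event \<open>E t\<close> as a set of past paths: all times that occur are
      at most \<open>t\<close>, hence coordinates of the path.\<close>
    define D where "D = {p\<in>space ?S. infdist (A *v p t - c t) Q < \<delta> \<and>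
        (\<forall>s\<in>F \<inter> {..<t}. \<not> infdist (A *v p s - c s) Q < \<delta>)}"
    have [measurable]: "(\<lambda>p. p t) \<in> borel_measurable ?S"
      using t0 by (intro measurable_component_singleton) auto
    have [measurable]: "Measurable.pred ?S (\<lambda>p. \<forall>s\<in>F \<inter> {..<t}. \<not> infdist (A *v p s - c s) Q < \<delta>)"
    proof (intro pred_intros_finite)
      fix s assume "s \<in> F \<inter> {..<t}"
      then have [measurable]: "(\<lambda>p. p s) \<in> borel_measurable ?S" using F by (intro measurable_component_singleton) auto
      show "Measurable.pred ?S (\<lambda>p. \<not> infdist (A *v p s - c s) Q < \<delta>)" by measurable
    qed (use F in auto)
    have D: "D \<in> sets ?S" unfolding D_def using t0 by measurable
    have ind: "(\<lambda>\<omega>. \<lambda>r\<in>{0..t}. B r \<omega> - B 0 \<omega>) \<in> measurable M ?S"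
      using indep_var_rv1[OF indep_past_future[OF t0(1)]] .
    have eq: "(\<lambda>r\<in>{0..t}. B r \<omega> - B 0 \<omega>) \<in> D \<longleftrightarrow> infdist (X t \<omega>) Q < \<delta> \<and> (\<forall>s\<in>F. s < t \<longrightarrow> \<not> infdist (X s \<omega>) Q < \<delta>)"
      if "\<omega> \<in> space M" for \<omega>
    proof -
      have "A *v (\<lambda>r\<in>{0..t}. B r \<omega> - B 0 \<omega>) s - c s = X s \<omega>" if "0 \<le> s" "s \<le> t" for s
        using that by (simp add: X_def)
      moreover have "0 \<le> s" if "s \<in> F" for s using that F by auto
      ultimately show ?thesis
        using t0 measurable_space[OF ind that] by (auto simp: D_def simp del: restrict_apply)
    qed
    have "\<kappa> * prob {\<omega>\<in>space M. (\<lambda>r\<in>{0..t}. B r \<omega> - B 0 \<omega>) \<in> D}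
      \<le> prob {\<omega>\<in>space M. (\<lambda>r\<in>{0..t}. B r \<omega> - B 0 \<omega>) \<in> D \<and> infdist (X T \<omega>) Q < \<delta>}"
      by (rule reach_neighbourhood_step) (use t0 Q \<kappa> D in \<open>auto simp: D_def\<close>)
    also have "{\<omega>\<in>space M. (\<lambda>r\<in>{0..t}. B r \<omega> - B 0 \<omega>) \<in> D} = E t"
      using eq by (auto simp: E_def simp del: restrict_apply)
    also have "{\<omega>\<in>space M. (\<lambda>r\<in>{0..t}. B r \<omega> - B 0 \<omega>) \<in> D \<and> infdist (X T \<omega>) Q < \<delta>} = E t \<inter> G"
      using eq by (auto simp: E_def G_def simp del: restrict_apply)
    finally show ?thesis .
  qed
  have disj: "disjoint_family_on E F"
    unfolding disjoint_family_on_def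
  proof (intro ballI impI)
    fix s t assume "s \<in> F" "t \<in> F" "s \<noteq> t"
    then show "E s \<inter> E t = {}" by (cases s t rule: linorder_cases) (auto simp: E_def)
  qed
  have U: "{\<omega>\<in>space M. \<exists>t\<in>F. infdist (X t \<omega>) Q < \<delta>} = (\<Union>t\<in>F. E t)"
  proof (intro equalityI subsetI)
    fix \<omega> assume "\<omega> \<in> {\<omega>\<in>space M. \<exists>t\<in>F. infdist (X t \<omega>) Q < \<delta>}"
    then have \<omega>: "\<omega> \<in> space M" "{t\<in>F. infdist (X t \<omega>) Q < \<delta>} \<noteq> {}" by auto
    let ?t = "Min {t\<in>F. infdist (X t \<omega>) Q < \<delta>}"
    have "?t \<in> {t\<in>F. infdist (X t \<omega>) Q < \<delta>}" using F \<omega> by (intro Min_in) auto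
    moreover have "\<not> infdist (X s \<omega>) Q < \<delta>" if "s \<in> F" "s < ?t" for s
    proof
      assume "infdist (X s \<omega>) Q < \<delta>"
      then have "?t \<le> s" using that F by (intro Min_le) auto
      with that show False by simp
    qed
    ultimately have "\<omega> \<in> E ?t" "?t \<in> F" using \<omega> by (auto simp: E_def)
    then show "\<omega> \<in> (\<Union>t\<in>F. E t)" by blast
  qed (auto simp: E_def)
  have "\<kappa> * prob (\<Union>t\<in>F. E t) = (\<Sum>t\<in>F. \<kappa> * prob (E t))"
    using F disj by (subst finite_measure_finite_Union) (auto simp: sum_distrib_left)
  also have "\<dots> \<le> (\<Sum>t\<in>F. prob (E t \<inter> G))" by (intro sum_mono step)
  also have "\<dots> = prob (\<Union>t\<in>F. E t \<inter> G)"
    using F disj by (subst finite_measure_finite_Union) (auto simp: disjoint_family_on_def)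
  also have "\<dots> \<le> prob G" by (intro finite_measure_mono) auto
  finally show ?thesis unfolding U G_def .
qed

text \<open>The finite bound has the same constant for every set of times, so it survives the
  increasing limit along an enumeration of \<open>D\<close>.\<close>

lemma reach_neighbourhood_countable:
  assumes D: "countable D" "D \<noteq> {}" "D \<subseteq> {0..T}" and Q: "Q \<noteq> {}" "closed Q"
    and \<kappa>: "0 \<le> \<kappa>" "\<And>x s. x \<in> Q \<Longrightarrow> 0 \<le> s \<Longrightarrow> s \<le> T \<Longrightarrow>
      \<kappa> \<le> prob {\<omega>\<in>space M. x + (A *v (B T \<omega> - B s \<omega>) - (c T - c s)) \<in> Q}"
  shows "\<kappa> * prob {\<omega>\<in>space M. \<exists>t\<in>D. infdist (X t \<omega>) Q < \<delta>} \<le> prob {\<omega>\<in>space M. infdist (X T \<omega>) Q < \<delta>}"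
proof -
  define t where "t = from_nat_into D"
  have t: "range t = D" using D by (simp add: t_def range_from_nat_into)
  then have tT: "t k \<in> {0..T}" for k using D(3) rangeI[of t k] by blast
  have [measurable]: "X (t k) \<in> borel_measurable M" for k using tT[of k] by (intro X_measurable) auto
  define E where "E n = {\<omega>\<in>space M. \<exists>k<n. infdist (X (t k) \<omega>) Q < \<delta>}" for n :: nat
  have "(\<lambda>n. prob (E n)) \<longlonglongrightarrow> prob (\<Union>n. E n)"
  proof (rule finite_Lim_measure_incseq)
    show "range E \<subseteq> events" unfolding E_def by auto
    show "incseq E" unfolding E_def by (auto simp: incseq_def intro: less_le_trans)
  qed
  then have "(\<lambda>n. \<kappa> * prob (E n)) \<longlonglongrightarrow> \<kappa> * prob (\<Union>n. E n)" by (intro tendsto_intros)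
  moreover have "\<kappa> * prob (E n) \<le> prob {\<omega>\<in>space M. infdist (X T \<omega>) Q < \<delta>}" for n
  proof -
    have "\<kappa> * prob {\<omega>\<in>space M. \<exists>r\<in>t ` {..<n}. infdist (X r \<omega>) Q < \<delta>} \<le> prob {\<omega>\<in>space M. infdist (X T \<omega>) Q < \<delta>}"
      using tT by (intro reach_neighbourhood_finite Q \<kappa>) auto
    then show ?thesis by (simp add: E_def Bex_def)
  qed
  ultimately have "\<kappa> * prob (\<Union>n. E n) \<le> prob {\<omega>\<in>space M. infdist (X T \<omega>) Q < \<delta>}"
    by (intro LIMSEQ_le_const2) auto
  also have "(\<Union>n. E n) = {\<omega>\<in>space M. \<exists>t\<in>D. infdist (X t \<omega>) Q < \<delta>}"
    unfolding E_def t[symmetric] by auto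
  finally show ?thesis .
qed

lemma hits_neighbourhoods_measurable:
  assumes "countable D" "D \<subseteq> {0..}"
  shows "{\<omega>\<in>space M. \<exists>t\<in>D. infdist (X t \<omega>) Q < \<delta>} \<in> sets M"
    and "{\<omega>\<in>space M. \<forall>m. \<exists>t\<in>D. infdist (X t \<omega>) Q < 1 / real (Suc m)} \<in> sets M"
proof -
  have *: "{\<omega>\<in>space M. \<exists>t\<in>D. infdist (X t \<omega>) Q < \<delta>} \<in> sets M" for \<delta>
  proof (rule sets.sets_Collect_countable_Ex')
    fix t assume "t \<in> D"
    then have [measurable]: "X t \<in> borel_measurable M" using assms by (intro X_measurable) auto
    show "{\<omega>\<in>space M. infdist (X t \<omega>) Q < \<delta>} \<in> sets M" by measurable
  qed fact
  then show "{\<omega>\<in>space M. \<exists>t\<in>D. infdist (X t \<omega>) Q < \<delta>} \<in> sets M" .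
  show "{\<omega>\<in>space M. \<forall>m. \<exists>t\<in>D. infdist (X t \<omega>) Q < 1 / real (Suc m)} \<in> sets M"
    by (intro sets.sets_Collect_countable_All *)
qed

lemma closed_hitting_sets:
  assumes Q: "closed Q"
  shows "{\<omega>\<in>space M. \<exists>t\<in>{0..T}. X t \<omega> \<in> Q} \<in> sets (completion M)"
\<comment> \<open>\<open>infdist\<close> to the empty set takes the default value 0, so the
  description by neighbourhoods is valid only for nonempty \<open>Q\<close>.\<close>
proof (cases "Q = {}")
  case False
  obtain D where D: "countable D" "D \<subseteq> {0..T}" "{0..T} \<subseteq> closure D"
    using separable by blast
  show ?thesis
  proof (rule completion_AE_cong(1)[OF sets_completionI_sets[OF hits_neighbourhoods_measurable(2)[of D Q]]])
    show "AE \<omega> in M. (\<exists>t\<in>{0..T}. X t \<omega> \<in> Q) \<longleftrightarrow> (\<forall>m. \<exists>t\<in>D. infdist (X t \<omega>) Q < 1 / real (Suc m))"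
      using AE_X_continuous by eventually_elim (intro hits_closed_iff Q False D)
  qed (use D in auto)
qed simp

text \<open>Almost surely a path that meets \<open>Q\<close> comes within \<open>1 / (m + 1)\<close>
  of \<open>Q\<close> at a time in \<open>D\<close>, for every \<open>m\<close>, so the countable
  bound applies with each such radius. The terminal events \<open>G m\<close> decrease, and since
  \<open>Q\<close> is closed their intersection lies in the event that \<open>X T\<close> is in
  \<open>Q\<close>.\<close>

lemma closed_hitting_bound:
  assumes Q: "closed Q"
    and \<kappa>: "0 \<le> \<kappa>" "\<And>x s. x \<in> Q \<Longrightarrow> 0 \<le> s \<Longrightarrow> s \<le> T \<Longrightarrow>
      \<kappa> \<le> prob {\<omega>\<in>space M. x + (A *v (B T \<omega> - B s \<omega>) - (c T - c s)) \<in> Q}"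
  shows "\<kappa> * measure (completion M) {\<omega>\<in>space M. \<exists>t\<in>{0..T}. X t \<omega> \<in> Q} \<le> prob {\<omega>\<in>space M. X T \<omega> \<in> Q}"
proof (cases "Q = {}")
  case False
  obtain D where D: "countable D" "D \<subseteq> {0..T}" "{0..T} \<subseteq> closure D"
    using separable by blast
  then have D_ne: "D \<noteq> {}" and D0: "D \<subseteq> {0..}" using T_pos by auto
  define E where "E = {\<omega>\<in>space M. \<forall>m. \<exists>t\<in>D. infdist (X t \<omega>) Q < 1 / real (Suc m)}"
  define G where "G m = {\<omega>\<in>space M. infdist (X T \<omega>) Q < 1 / real (Suc m)}" for m
  have [measurable]: "X T \<in> borel_measurable M" using T_pos by (intro X_measurable) auto
  have Em: "E \<in> sets M"
    unfolding E_def using D D0 by (intro hits_neighbourhoods_measurable)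
  have "measure (completion M) {\<omega>\<in>space M. \<exists>t\<in>{0..T}. X t \<omega> \<in> Q} = measure (completion M) E"
    unfolding E_def
  proof (rule completion_AE_cong(2))
    show "{\<omega>\<in>space M. \<forall>m. \<exists>t\<in>D. infdist (X t \<omega>) Q < 1 / real (Suc m)} \<in> sets (completion M)"
      using Em by (simp add: E_def)
    show "AE \<omega> in M. (\<exists>t\<in>{0..T}. X t \<omega> \<in> Q) \<longleftrightarrow> (\<forall>m. \<exists>t\<in>D. infdist (X t \<omega>) Q < 1 / real (Suc m))"
      using AE_X_continuous by eventually_elim (intro hits_closed_iff Q False D)
  qed
  with Em have E: "measure (completion M) {\<omega>\<in>space M. \<exists>t\<in>{0..T}. X t \<omega> \<in> Q} = prob E" by simp
  have le: "\<kappa> * prob E \<le> prob (G m)" for m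
  proof -
    have "prob E \<le> prob {\<omega>\<in>space M. \<exists>t\<in>D. infdist (X t \<omega>) Q < 1 / real (Suc m)}"
      by (rule finite_measure_mono[OF _ hits_neighbourhoods_measurable(1)]) (use D D0 in \<open>auto simp: E_def\<close>)
    then have "\<kappa> * prob E \<le> \<kappa> * prob {\<omega>\<in>space M. \<exists>t\<in>D. infdist (X t \<omega>) Q < 1 / real (Suc m)}"
      using \<kappa>(1) by (intro mult_left_mono)
    also have "\<dots> \<le> prob (G m)"
      unfolding G_def by (rule reach_neighbourhood_countable[OF D(1) D_ne D(2) False Q \<kappa>])
    finally show ?thesis .
  qed
  have "(\<lambda>m. prob (G m)) \<longlonglongrightarrow> prob (\<Inter>m. G m)"
  proof (rule finite_Lim_measure_decseq)
    have "G m \<in> events" for m unfolding G_def by measurable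
    then show "range G \<subseteq> events" by auto
    have "1 / real (Suc n) \<le> 1 / real (Suc m)" if "m \<le> n" for m n
      using that by (intro divide_left_mono) auto
    then show "decseq G" unfolding G_def decseq_def by (auto intro: less_le_trans)
  qed
  then have le': "\<kappa> * prob E \<le> prob (\<Inter>m. G m)" using le by (intro LIMSEQ_le_const) auto
  have "(\<Inter>m. G m) \<subseteq> {\<omega>\<in>space M. X T \<omega> \<in> Q}"
  proof
    fix \<omega> assume \<omega>: "\<omega> \<in> (\<Inter>m. G m)"
    then have "infdist (X T \<omega>) Q < 1 / real (Suc m)" for m by (auto simp: G_def)
    then have "\<not> 0 < infdist (X T \<omega>) Q"
      by (metis nat_approx_posE less_asym)
    then have "infdist (X T \<omega>) Q = 0" using infdist_nonneg[of "X T \<omega>" Q] by simp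
    then show "\<omega> \<in> {\<omega>\<in>space M. X T \<omega> \<in> Q}" using \<omega> Q False by (auto simp: G_def in_closed_iff_infdist_zero)
  qed
  moreover have "{\<omega>\<in>space M. X T \<omega> \<in> Q} \<in> sets M"
    using borel_closed[OF Q] by measurable
  ultimately have "prob (\<Inter>m. G m) \<le> prob {\<omega>\<in>space M. X T \<omega> \<in> Q}"
    by (intro finite_measure_mono)
  with le' show ?thesis unfolding E by simp
qed simp

end

section \<open>Upper sets and cones\<close>

lemma open_null_sets_lborel:
  fixes U :: "'a::euclidean_space set"
  assumes "open U" "U \<in> null_sets lborel"
  shows "U = {}"
proof (rule ccontr)
  assume "U \<noteq> {}"
  then obtain x where "x \<in> U" by auto
  then obtain a b where ab: "x \<in> box a b" "box a b \<subseteq> U"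
    using assms(1) open_contains_box[of U x] by metis
  define p where "p = (\<Prod>i\<in>Basis. (b - a) \<bullet> i)"
  from ab have "emeasure lborel (box a b) = ennreal p" unfolding p_def
    by (intro emeasure_lborel_box) (auto simp: mem_box intro: less_imp_le order_less_trans)
  moreover have "0 < p"
    using ab(1) unfolding p_def by (intro prod_pos) (force simp: mem_box inner_diff_left)
  moreover have "emeasure lborel (box a b) = 0"
    using null_sets_subset[OF assms(2) _ ab(2)] by auto
  ultimately show False by simp
qed

text \<open>Some \<open>z\<close> in \<open>U\<close> is closer than \<open>s\<close> to
  \<open>y\<close>. After the shift each coordinate exceeds that of \<open>z\<close> by at least
  \<open>s - dist y z\<close>, which leaves room for a ball of this radius.\<close>

lemma upper_set_shift_interior:
  fixes U :: "(real^'n) set"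
  assumes up: "\<And>x y. x \<in> U \<Longrightarrow> (\<And>i. x $ i \<le> y $ i) \<Longrightarrow> y \<in> U"
    and U: "U \<noteq> {}" "infdist y U < s"
  shows "y + s *\<^sub>R (\<chi> i. 1) \<in> interior U"
proof -
  obtain z where z: "z \<in> U" "dist y z < s" using infdist_lessE[OF U] by metis
  have "ball (y + s *\<^sub>R (\<chi> i. 1)) (s - dist y z) \<subseteq> U"
  proof
    fix x assume x: "x \<in> ball (y + s *\<^sub>R (\<chi> i. 1)) (s - dist y z)"
    have "z $ i \<le> x $ i" for i
      using x component_le_norm_cart[of "y + s *\<^sub>R (\<chi> i. 1) - x" i] component_le_norm_cart[of "y - z" i]
      by (simp add: dist_norm)
    then show "x \<in> U" using up[OF z(1)] by blast
  qed
  moreover have "y + s *\<^sub>R (\<chi> i. 1) \<in> ball (y + s *\<^sub>R (\<chi> i. 1)) (s - dist y z)"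
    using z by simp
  ultimately show ?thesis by (rule interiorI[OF open_ball, rotated])
qed

section \<open>Absolute continuity and full support of the increments\<close>

context vector_brownian_motion
begin

lemma distr_increment:
  assumes "0 \<le> s" "s < t"
  shows "distr M borel (\<lambda>\<omega>. B t \<omega> - B s \<omega>)
    = density lborel (\<lambda>x. ennreal (\<Prod>i\<in>UNIV. normal_density 0 (sqrt (t - s)) (x $ i)))"
proof -
  have "distr M borel (\<lambda>\<omega>. \<chi> i. (B t \<omega> - B s \<omega>) $ i)
    = density lborel (\<lambda>x. ennreal (\<Prod>i\<in>UNIV. normal_density 0 (sqrt (t - s)) (x $ i)))"
    using assms by (intro distr_vec_indep_density indep_increment_components increment_component_distributed) auto
  then show ?thesis by (simp only: vec_lambda_eta)
qed

lemma increment_measurable: "0 \<le> s \<Longrightarrow> 0 \<le> t \<Longrightarrow> (\<lambda>\<omega>. B t \<omega> - B s \<omega>) \<in> borel_measurable M"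
  by (intro borel_measurable_diff B_measurable)

lemma increment_null_sets:
  assumes "0 \<le> s" "s < t" "N \<in> null_sets lborel"
  shows "N \<in> null_sets (distr M borel (\<lambda>\<omega>. B t \<omega> - B s \<omega>))"
  unfolding distr_increment[OF assms(1,2)]
proof (subst null_sets_density_iff)
  show "N \<in> sets lborel \<and> (AE x in lborel. x \<in> N \<longrightarrow> ennreal (\<Prod>i\<in>UNIV. normal_density 0 (sqrt (t - s)) (x $ i)) = 0)"
    using assms(3) AE_not_in[OF assms(3)] by (auto elim: eventually_mono)
qed measurable

text \<open>The Gaussian density is positive everywhere, so an open set of probability 0 would be a
  Lebesgue null set and hence empty.\<close>

lemma increment_open_prob_pos:
  assumes st: "0 \<le> s" "s < t" and U: "open U" "U \<noteq> {}"
  shows "0 < prob {\<omega>\<in>space M. B t \<omega> - B s \<omega> \<in> U}"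
proof (rule ccontr)
  have [measurable]: "(\<lambda>\<omega>. B t \<omega> - B s \<omega>) \<in> borel_measurable M"
    using st by (intro increment_measurable) auto
  assume "\<not> ?thesis"
  then have "prob {\<omega>\<in>space M. B t \<omega> - B s \<omega> \<in> U} = 0" using measure_nonneg[of M] by (simp add: not_less antisym)
  then have "emeasure (distr M borel (\<lambda>\<omega>. B t \<omega> - B s \<omega>)) U = 0"
    using U by (simp add: emeasure_distr emeasure_eq_measure vimage_def Int_def conj_commute)
  then have "U \<in> null_sets (density lborel (\<lambda>x. ennreal (\<Prod>i\<in>UNIV. normal_density 0 (sqrt (t - s)) (x $ i))))"
    unfolding distr_increment[OF st] using U by (intro null_setsI) auto
  then have "AE x in lborel. x \<in> U \<longrightarrow> ennreal (\<Prod>i\<in>UNIV. normal_density 0 (sqrt (t - s)) (x $ i)) = 0"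
    by (subst (asm) null_sets_density_iff) auto
  moreover have "\<not> (\<Prod>i\<in>UNIV. normal_density 0 (sqrt (t - s)) (x $ i)) \<le> 0" for x :: "real^'n"
    unfolding not_le using st by (intro prod_pos) (auto intro!: normal_density_pos)
  ultimately have "AE x in lborel. x \<notin> U"
    by (auto elim!: eventually_mono simp: ennreal_eq_0_iff)
  then have "U \<in> null_sets lborel" using U by (subst (asm) AE_iff_null_sets[symmetric]) auto
  with U open_null_sets_lborel show False by blast
qed

end

context drifted_brownian_motion
begin

text \<open>The comparison replaces the increment by \<open>r\<close> times \<open>B T - B 0\<close> with \<open>r < 1\<close>, and the cone
  property of \<open>K\<close> absorbs \<open>r\<close>.\<close>

lemma cone_prob_ge:
  assumes s: "0 \<le> s" "s < T" and K[measurable]: "K \<in> sets borel"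
    and cone: "\<And>C. 1 < C \<Longrightarrow> K \<subseteq> (\<lambda>w. C *\<^sub>R w) ` K"
  shows "exp (- (norm (matrix_inv A *v ((c T - c s) /\<^sub>R sqrt (T - s))))\<^sup>2) / 2 powr (real CARD('n) / 2)
         * prob {\<omega>\<in>space M. A *v (B T \<omega> - B 0 \<omega>) \<in> K}
    \<le> prob {\<omega>\<in>space M. A *v (B T \<omega> - B s \<omega>) - (c T - c s) \<in> K}"
proof -
  define \<sigma> where "\<sigma> = sqrt (T - s)"
  have \<sigma>: "0 < \<sigma>" using s by (simp add: \<sigma>_def)
  \<comment> \<open>Applying \<open>matrix_inv A\<close> to the drifted increment gives
    \<open>B T - B s\<close> shifted by \<open>m\<close>, so \<open>m\<close> is the mean in the
    Gaussian comparison.\<close>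
  define m where "m = - (matrix_inv A *v (c T - c s))"
  \<comment> \<open>Chosen so that \<open>r * sqrt T = \<sigma> / sqrt 2\<close>: then
    \<open>r\<close> times \<open>B T - B 0\<close> has half the variance of the increment after
    \<open>s\<close>.\<close>
  define r where "r = \<sigma> / sqrt (2 * T)"
  have r: "0 < r" "r < 1"
    using T_pos s by (auto simp: r_def \<sigma>_def)
  let ?X = "\<lambda>i \<omega>. m $ i + 1 * (B T \<omega> - B s \<omega>) $ i"
  let ?Y = "\<lambda>i \<omega>. 0 + r * (B T \<omega> - B 0 \<omega>) $ i"
  let ?G = "(\<lambda>y. A *v y) -` K"
  have [measurable]: "(\<lambda>\<omega>. B T \<omega> - B s \<omega>) \<in> borel_measurable M" "(\<lambda>\<omega>. B T \<omega> - B 0 \<omega>) \<in> borel_measurable M"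
    using s T_pos by (auto intro!: increment_measurable)
  have G: "?G \<in> sets borel"
    using measurable_sets[OF borel_measurable_matrix_vector_mult[of "\<lambda>x. x" borel A] K] by simp
  have X: "indep_vars (\<lambda>_. borel) ?X UNIV"
    by (rule indep_vars_compose2[OF indep_increment_components[of s T], where Y = "\<lambda>i x. m $ i + 1 * x"])
       (use s in auto)
  have Y: "indep_vars (\<lambda>_. borel) ?Y UNIV"
    by (rule indep_vars_compose2[OF indep_increment_components[of 0 T], where Y = "\<lambda>i x. 0 + r * x"])
       (use T_pos in auto)
  have dX: "distributed M lborel (?X i) (normal_density (m $ i) \<sigma>)" for i
    using normal_density_affine[OF increment_component_distributed[OF s, of i], of 1 "m $ i"] s
    by (simp add: \<sigma>_def)
  have "r * sqrt T = \<sigma> / sqrt 2" using T_pos by (simp add: r_def real_sqrt_mult)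
  then have dY: "distributed M lborel (?Y i) (normal_density 0 (\<sigma> / sqrt 2))" for i
    using normal_density_affine[OF increment_component_distributed[of 0 T i], of r 0] T_pos r
    by simp
  have nm: "(norm m)\<^sup>2 / \<sigma>\<^sup>2 = (norm (matrix_inv A *v ((c T - c s) /\<^sub>R \<sigma>)))\<^sup>2"
    using \<sigma> unfolding m_def matrix_vector_mult_scaleR
    by (simp add: power_mult_distrib power_inverse divide_inverse mult.commute)
  have sub: "{\<omega>\<in>space M. A *v (B T \<omega> - B 0 \<omega>) \<in> K} \<subseteq> {\<omega>\<in>space M. (\<chi> i. ?Y i \<omega>) \<in> ?G}"
  proof
    fix \<omega> assume \<omega>: "\<omega> \<in> {\<omega>\<in>space M. A *v (B T \<omega> - B 0 \<omega>) \<in> K}"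
    have "1 < 1 / r" using r by simp
    \<comment> \<open>With factor \<open>1 / r\<close> the cone property writes the vector as a
      point \<open>k\<close> of \<open>K\<close> divided by \<open>r\<close>; scaling back by
      \<open>r\<close> gives \<open>k\<close>.\<close>
    from cone[OF this] \<omega> obtain k where k: "k \<in> K" "A *v (B T \<omega> - B 0 \<omega>) = (1 / r) *\<^sub>R k" by auto
    have "(\<chi> i. ?Y i \<omega>) = r *\<^sub>R (B T \<omega> - B 0 \<omega>)" by (simp add: vec_eq_iff)
    then have "A *v (\<chi> i. ?Y i \<omega>) = k" using k r by (simp add: matrix_vector_mult_scaleR)
    then show "\<omega> \<in> {\<omega>\<in>space M. (\<chi> i. ?Y i \<omega>) \<in> ?G}" using \<omega> k by simp
  qed
  have Gm: "{\<omega>\<in>space M. (\<chi> i. ?Y i \<omega>) \<in> ?G} \<in> sets M"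
  proof -
    have "(\<lambda>\<omega>. \<chi> i. ?Y i \<omega>) \<in> borel_measurable M"
      by (intro borel_measurable_vec_lambda) measurable
    with G show ?thesis by measurable
  qed
  have "exp (- (norm m)\<^sup>2 / \<sigma>\<^sup>2) / 2 powr (real CARD('n) / 2) * prob {\<omega>\<in>space M. A *v (B T \<omega> - B 0 \<omega>) \<in> K}
    \<le> exp (- (norm m)\<^sup>2 / \<sigma>\<^sup>2) / 2 powr (real CARD('n) / 2) * prob {\<omega>\<in>space M. (\<chi> i. ?Y i \<omega>) \<in> ?G}"
    using sub Gm by (intro mult_left_mono finite_measure_mono) auto
  also have "\<dots> \<le> prob {\<omega>\<in>space M. (\<chi> i. ?X i \<omega>) \<in> ?G}"
    by (rule normal_shift_prob_ge[OF \<sigma> X dX Y dY G])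
  also have "{\<omega>\<in>space M. (\<chi> i. ?X i \<omega>) \<in> ?G} = {\<omega>\<in>space M. A *v (B T \<omega> - B s \<omega>) - (c T - c s) \<in> K}"
  proof -
    have "A *v (\<chi> i. ?X i \<omega>) = A *v (B T \<omega> - B s \<omega>) - (c T - c s)" for \<omega>
    proof -
      have "(\<chi> i. ?X i \<omega>) = (B T \<omega> - B s \<omega>) - matrix_inv A *v (c T - c s)" by (simp add: vec_eq_iff m_def)
      then show ?thesis
        by (simp only: matrix_vector_mult_diff_distrib[of A] matrix_inv_vector_mult(1)[OF inv_A])
    qed
    then show ?thesis by simp
  qed
  finally show ?thesis using nm by (simp add: \<sigma>_def)
qed

text \<open>Condition on the increments after time \<open>e\<close>. The exceptional values of \<open>B e - B 0\<close> then have
  disjoint translates in the direction \<open>matrix_inv A *v (1, \<dots>, 1)\<close>, so they form a null set. At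
  \<open>e = 0\<close> the statement fails, because the start is deterministic.\<close>

lemma AE_upper_set_hitting:
  fixes U :: "(real^'n) set"
  assumes e: "0 < e" "e \<le> T" and D: "countable D" "D \<subseteq> {e..}"
    and up: "\<And>x y. x \<in> U \<Longrightarrow> (\<And>i. x $ i \<le> y $ i) \<Longrightarrow> y \<in> U" and U: "U \<noteq> {}"
  shows "AE \<omega> in M. (\<forall>m. \<exists>t\<in>D. infdist (X t \<omega>) U < 1 / real (Suc m)) \<longrightarrow> (\<exists>t\<in>D. X t \<omega> \<in> interior U)"
proof -
  let ?F = "PiM {e..} (\<lambda>_. borel :: (real^'n) measure)"
  let ?S = "PiM {0..e} (\<lambda>_. borel :: (real^'n) measure)"
  let ?p = "\<lambda>\<omega>. \<lambda>r\<in>{0..e}. B r \<omega> - B 0 \<omega>"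
  let ?f = "\<lambda>\<omega>. \<lambda>r\<in>{e..}. B r \<omega> - B e \<omega>" and ?b = "\<lambda>\<omega>. B e \<omega> - B 0 \<omega>"
  have e0: "0 \<le> e" using e by simp
  note ind = indep_past_future[OF e0]
  have p[measurable]: "?p \<in> measurable M ?S" and f[measurable]: "?f \<in> measurable M ?F"
    using indep_var_rv1[OF ind] indep_var_rv2[OF ind] by auto
  have b[measurable]: "?b \<in> borel_measurable M" using e0 by (intro increment_measurable) auto
  interpret P1: prob_space "distr M ?S ?p" by (rule prob_space_distr) simp
  interpret P2: prob_space "distr M ?F ?f" by (rule prob_space_distr) simp
  interpret P: pair_sigma_finite "distr M ?S ?p" "distr M ?F ?f" ..
  \<comment> \<open>Here \<open>x\<close> stands for \<open>B e - B 0\<close> and \<open>g\<close>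
    for the increments after \<open>e\<close>; with these arguments \<open>Y\<close> is the value of
    \<open>X\<close> at a time \<open>t \<ge> e\<close>.\<close>
  define Y where "Y x g t = A *v x + (A *v g t - c t)" for x :: "real^'n" and g :: "real \<Rightarrow> real^'n" and t
  define R where "R x g \<longleftrightarrow> (\<forall>m. \<exists>t\<in>D. infdist (Y x g t) U < 1 / real (Suc m)) \<and> \<not> (\<exists>t\<in>D. Y x g t \<in> interior U)" for x g
  define C where "C = {y\<in>space (?S \<Otimes>\<^sub>M ?F). R (fst y e) (snd y)}"
  have C[measurable]: "C \<in> sets (?S \<Otimes>\<^sub>M ?F)"
    unfolding C_def R_def
  proof (intro sets.sets_Collect_conj sets.sets_Collect_neg sets.sets_Collect_countable_All
        sets.sets_Collect_countable_Ex' D)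
    fix t assume "t \<in> D"
    then have [measurable]: "(\<lambda>g. g t) \<in> borel_measurable ?F" "(\<lambda>p. p e) \<in> borel_measurable ?S"
      using e0 D by (auto intro!: measurable_component_singleton)
    have [measurable]: "(\<lambda>y. Y (fst y e) (snd y) t) \<in> borel_measurable (?S \<Otimes>\<^sub>M ?F)"
      unfolding Y_def by measurable
    have [measurable]: "interior U \<in> sets borel" by simp
    show "{y\<in>space (?S \<Otimes>\<^sub>M ?F). infdist (Y (fst y e) (snd y) t) U < 1 / real (Suc m)} \<in> sets (?S \<Otimes>\<^sub>M ?F)" for m
      by measurable
    show "{y\<in>space (?S \<Otimes>\<^sub>M ?F). Y (fst y e) (snd y) t \<in> interior U} \<in> sets (?S \<Otimes>\<^sub>M ?F)"
      by measurable
  qed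
  have N: "{x. R x g} \<in> null_sets lborel" for g
  proof (rule null_sets_disjoint_translates)
    have "{x\<in>space borel. R x g} \<in> sets borel"
      unfolding R_def
    proof (intro sets.sets_Collect_conj sets.sets_Collect_neg sets.sets_Collect_countable_All
        sets.sets_Collect_countable_Ex' D)
      fix t
      have [measurable]: "(\<lambda>x. Y x g t) \<in> borel_measurable borel"
        unfolding Y_def by measurable
      have [measurable]: "interior U \<in> sets borel" by simp
      show "{x\<in>space borel. infdist (Y x g t) U < 1 / real (Suc m)} \<in> sets borel" for m
        by measurable
      show "{x\<in>space borel. Y x g t \<in> interior U} \<in> sets borel"
        by measurable
    qed
    then show "{x. R x g} \<in> sets borel" by simp
    fix x and s :: real
    assume x: "x \<in> {x. R x g}" and s: "0 < s"
    \<comment> \<open>One time at which \<open>Y\<close> is closer than \<open>s\<close> to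
      \<open>U\<close> suffices: translating \<open>x\<close> raises \<open>Y\<close> by
      \<open>s\<close> in all coordinates, hence into the interior, which the exceptional set
      excludes.\<close>
    obtain m where m: "1 / real (Suc m) < s" using nat_approx_posE[OF s] by metis
    from x obtain t where t: "t \<in> D" "infdist (Y x g t) U < 1 / real (Suc m)" by (auto simp: R_def)
    then have "Y x g t + s *\<^sub>R (\<chi> i. 1) \<in> interior U"
      using m by (intro upper_set_shift_interior[OF up U]) auto
    moreover have "Y (x + s *\<^sub>R (matrix_inv A *v (\<chi> i. 1))) g t = Y x g t + s *\<^sub>R (\<chi> i. 1)"
      by (simp add: Y_def matrix_vector_right_distrib matrix_vector_mult_scaleR matrix_inv_vector_mult(1)[OF inv_A])
    ultimately have "\<exists>t\<in>D. Y (x + s *\<^sub>R (matrix_inv A *v (\<chi> i. 1))) g t \<in> interior U"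
      using t(1) by metis
    then show "x + s *\<^sub>R (matrix_inv A *v (\<chi> i. 1)) \<notin> {x. R x g}"
      unfolding R_def by blast
  qed
  have sec: "emeasure (distr M ?S ?p) ((\<lambda>p. (p, g)) -` C) = 0" if g: "g \<in> space ?F" for g
  proof -
    have "{x. R x g} \<in> null_sets (distr M borel ?b)"
      using N e by (intro increment_null_sets) auto
    then have "emeasure M (?b -` {x. R x g} \<inter> space M) = 0"
      using N[of g] by (subst emeasure_distr[OF b, symmetric]) auto
    \<comment> \<open>The past enters \<open>C\<close> only through its value at \<open>e\<close>,
      so the section is an event of the single vector \<open>B e - B 0\<close>, whose law has a
      density.\<close>
    moreover have "?p -` ((\<lambda>p. (p, g)) -` C) \<inter> space M = ?b -` {x. R x g} \<inter> space M"
      using e0 g measurable_space[OF p] by (auto simp: C_def space_pair_measure)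
    ultimately show ?thesis
      using sets_Pair2[OF C] by (subst emeasure_distr) auto
  qed
  have "emeasure M ((\<lambda>\<omega>. (?p \<omega>, ?f \<omega>)) -` C \<inter> space M) = emeasure (distr M (?S \<Otimes>\<^sub>M ?F) (\<lambda>\<omega>. (?p \<omega>, ?f \<omega>))) C"
    by (subst emeasure_distr) auto
  also have "distr M (?S \<Otimes>\<^sub>M ?F) (\<lambda>\<omega>. (?p \<omega>, ?f \<omega>)) = distr M ?S ?p \<Otimes>\<^sub>M distr M ?F ?f"
    using ind unfolding indep_var_distribution_eq by simp
  also have "emeasure \<dots> C = (\<integral>\<^sup>+g. emeasure (distr M ?S ?p) ((\<lambda>p. (p, g)) -` C) \<partial>distr M ?F ?f)"
    by (rule P.emeasure_pair_measure_alt2) (auto cong: sets_pair_measure_cong)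
  also have "\<dots> = (\<integral>\<^sup>+g. 0 \<partial>distr M ?F ?f)"
    by (intro nn_integral_cong sec) auto
  also have "\<dots> = 0" by simp
  finally have "(\<lambda>\<omega>. (?p \<omega>, ?f \<omega>)) -` C \<inter> space M \<in> null_sets M"
    by (rule null_setsI) (rule measurable_sets[OF measurable_Pair[OF p f] C])
  then have "AE \<omega> in M. \<omega> \<notin> (\<lambda>\<omega>. (?p \<omega>, ?f \<omega>)) -` C \<inter> space M" by (rule AE_not_in)
  then show ?thesis
  proof (rule AE_mp, intro AE_I2 impI)
    fix \<omega> assume \<omega>: "\<omega> \<in> space M" "\<omega> \<notin> (\<lambda>\<omega>. (?p \<omega>, ?f \<omega>)) -` C \<inter> space M"
      and h: "\<forall>m. \<exists>t\<in>D. infdist (X t \<omega>) U < 1 / real (Suc m)"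
    have eq: "Y (?p \<omega> e) (?f \<omega>) t = X t \<omega>" if "t \<in> D" for t
    proof -
      have "e \<le> t" using that D by auto
      then show ?thesis using e0 by (simp add: Y_def X_def matrix_vector_mult_diff_distrib)
    qed
    have "\<not> R (?p \<omega> e) (?f \<omega>)"
      using \<omega> measurable_space[OF p \<omega>(1)] measurable_space[OF f \<omega>(1)]
      by (auto simp: C_def space_pair_measure simp del: restrict_apply)
    moreover have "\<forall>m. \<exists>t\<in>D. infdist (Y (?p \<omega> e) (?f \<omega>) t) U < 1 / real (Suc m)"
    proof
      fix m
      obtain t where "t \<in> D" "infdist (X t \<omega>) U < 1 / real (Suc m)" using h by metis
      then show "\<exists>t\<in>D. infdist (Y (?p \<omega> e) (?f \<omega>) t) U < 1 / real (Suc m)"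
        by (intro bexI[of _ t]) (simp_all only: eq)
    qed
    ultimately obtain t where "t \<in> D" "Y (?p \<omega> e) (?f \<omega>) t \<in> interior U"
      unfolding R_def by blast
    then show "\<exists>t\<in>D. X t \<omega> \<in> interior U" using eq by metis
  qed
qed

text \<open>\<open>U\<close> need not be a Borel set; its hitting event is trapped between those of its interior and
  its closure.\<close>

lemma AE_upper_set_hits_interior:
  fixes U :: "(real^'n) set"
  assumes e: "0 < e" "e \<le> T"
    and up: "\<And>x y. x \<in> U \<Longrightarrow> (\<And>i. x $ i \<le> y $ i) \<Longrightarrow> y \<in> U"
  shows "AE \<omega> in M. (\<exists>t\<in>{e..T}. X t \<omega> \<in> closure U) \<longrightarrow> (\<exists>t\<in>{e..T}. X t \<omega> \<in> interior U)"
proof (cases "U = {}")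
  case False
  obtain D where D: "countable D" "D \<subseteq> {e..T}" "{e..T} \<subseteq> closure D"
    using separable by blast
  \<comment> \<open>The dense-time criterion is applied to the closed set \<open>closure U\<close>,
    while \<open>AE_upper_set_hitting\<close> measures the distance to \<open>U\<close>.\<close>
  have [simp]: "infdist x (closure U) = infdist x U" for x
    by (simp add: infdist_eq_setdist)
  have "AE \<omega> in M. (\<forall>m. \<exists>t\<in>D. infdist (X t \<omega>) U < 1 / real (Suc m)) \<longrightarrow> (\<exists>t\<in>D. X t \<omega> \<in> interior U)"
    using e D up False by (intro AE_upper_set_hitting) auto
  then show ?thesis using AE_X_continuous
  proof eventually_elim
    case (elim \<omega>)
    then have "continuous_on {e..T} (\<lambda>t. X t \<omega>)" using e by (auto intro: continuous_on_subset)
    from hits_closed_iff[OF this, of "closure U" D] elim D False show ?case by auto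
  qed
qed simp

text \<open>Continuous paths show a hit of the open interior at countably many times, which gives an
  event in \<open>M\<close>; by \<open>AE_upper_set_hits_interior\<close> hitting \<open>U\<close>
  is almost surely the same event.\<close>

lemma upper_set_hitting_sets_pos:
  fixes U :: "(real^'n) set"
  assumes e: "0 < e" "e \<le> T"
    and up: "\<And>x y. x \<in> U \<Longrightarrow> (\<And>i. x $ i \<le> y $ i) \<Longrightarrow> y \<in> U"
  shows "{\<omega>\<in>space M. \<exists>t\<in>{e..T}. X t \<omega> \<in> U} \<in> sets (completion M)"
proof -
  obtain D where D: "countable D" "D \<subseteq> {e..T}" "{e..T} \<subseteq> closure D"
    using separable by blast
  show ?thesis
  proof (rule completion_AE_cong(1)[where P' = "\<lambda>\<omega>. \<exists>t\<in>D. X t \<omega> \<in> interior U"])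
    show "{\<omega>\<in>space M. \<exists>t\<in>D. X t \<omega> \<in> interior U} \<in> sets (completion M)"
    proof (rule sets_completionI_sets, rule sets.sets_Collect_countable_Ex')
      fix t assume "t \<in> D"
      then have [measurable]: "X t \<in> borel_measurable M" using e D by (intro X_measurable) auto
      have [measurable]: "interior U \<in> sets borel" by simp
      show "{\<omega>\<in>space M. X t \<omega> \<in> interior U} \<in> sets M" by measurable
    qed fact
    have "AE \<omega> in M. (\<exists>t\<in>{e..T}. X t \<omega> \<in> closure U) \<longrightarrow> (\<exists>t\<in>{e..T}. X t \<omega> \<in> interior U)"
      by (rule AE_upper_set_hits_interior[OF e], rule up)
    then show "AE \<omega> in M. (\<exists>t\<in>{e..T}. X t \<omega> \<in> U) \<longleftrightarrow> (\<exists>t\<in>D. X t \<omega> \<in> interior U)"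
      using AE_X_continuous
    proof eventually_elim
      case (elim \<omega>)
      then have "continuous_on {e..T} (\<lambda>t. X t \<omega>)" using e by (auto intro: continuous_on_subset)
      from hits_open_iff[OF this open_interior D(2,3), of U] elim(1) closure_subset[of U] interior_subset[of U]
      show ?case by blast
    qed
  qed
qed

text \<open>Time 0 is treated apart, and the positive times are exhausted by the intervals from
  \<open>T / (m + 1)\<close> to \<open>T\<close>.\<close>

lemma upper_set_hitting_sets:
  fixes U :: "(real^'n) set"
  assumes up: "\<And>x y. x \<in> U \<Longrightarrow> (\<And>i. x $ i \<le> y $ i) \<Longrightarrow> y \<in> U"
  shows "{\<omega>\<in>space M. \<exists>t\<in>{0..T}. X t \<omega> \<in> U} \<in> sets (completion M)"
proof -
  have "{\<omega>\<in>space M. \<exists>t\<in>{0..T}. X t \<omega> \<in> U}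
     = {\<omega>\<in>space M. X 0 \<omega> \<in> U} \<union> (\<Union>m. {\<omega>\<in>space M. \<exists>t\<in>{T / real (Suc m)..T}. X t \<omega> \<in> U})" (is "?L = ?R")
  proof (intro equalityI subsetI)
    fix \<omega> assume "\<omega> \<in> ?L"
    then obtain t where t: "\<omega> \<in> space M" "0 \<le> t" "t \<le> T" "X t \<omega> \<in> U" by auto
    show "\<omega> \<in> ?R"
    proof (cases "t = 0")
      case False
      with t T_pos have "0 < t / T" by simp
      then obtain m where "1 / real (Suc m) < t / T" using nat_approx_posE by metis
      then have "T / real (Suc m) \<le> t" using T_pos by (simp add: field_simps)
      with t have "\<omega> \<in> {\<omega>\<in>space M. \<exists>t\<in>{T / real (Suc m)..T}. X t \<omega> \<in> U}" by auto
      then show ?thesis by blast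
    qed (use t in auto)
  next
    fix \<omega> assume \<omega>: "\<omega> \<in> ?R"
    then consider "\<omega> \<in> space M" "X 0 \<omega> \<in> U"
      | m t where "\<omega> \<in> space M" "T / real (Suc m) \<le> t" "t \<le> T" "X t \<omega> \<in> U" by auto
    then show "\<omega> \<in> ?L"
    proof cases
      case 1
      then show ?thesis using T_pos by auto
    next
      case (2 m t)
      have "0 \<le> T / real (Suc m)" using T_pos by simp
      then have "0 \<le> t" using 2(2) by (rule order_trans)
      with 2 show ?thesis by auto
    qed
  qed
  moreover have "{\<omega>\<in>space M. X 0 \<omega> \<in> U} \<in> sets (completion M)"
    \<comment> \<open>\<open>X 0\<close> is the constant \<open>- c 0\<close>, so this event is
      either empty or the whole space.\<close>
    by (cases "- c 0 \<in> U") (auto simp: X_def)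
  moreover have "{\<omega>\<in>space M. \<exists>t\<in>{T / real (Suc m)..T}. X t \<omega> \<in> U} \<in> sets (completion M)" for m
  proof (rule upper_set_hitting_sets_pos)
    show "0 < T / real (Suc m)" using T_pos by simp
    show "T / real (Suc m) \<le> T" using T_pos by (simp add: divide_le_eq)
  qed (rule up)
  ultimately show ?thesis by auto
qed

text \<open>The interval from \<open>T\<close> to \<open>T\<close> is a case of
  \<open>AE_upper_set_hits_interior\<close>: almost surely \<open>X T\<close> lies in the interior
  of \<open>U\<close> as soon as it lies in the closure.\<close>

lemma upper_set_terminal:
  fixes U :: "(real^'n) set"
  assumes up: "\<And>x y. x \<in> U \<Longrightarrow> (\<And>i. x $ i \<le> y $ i) \<Longrightarrow> y \<in> U"
  shows "{\<omega>\<in>space M. X T \<omega> \<in> U} \<in> sets (completion M)"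
    and "measure (completion M) {\<omega>\<in>space M. X T \<omega> \<in> U} = prob {\<omega>\<in>space M. X T \<omega> \<in> closure U}"
proof -
  have [measurable]: "X T \<in> borel_measurable M" using T_pos by (intro X_measurable) auto
  have [measurable]: "closure U \<in> sets borel" by simp
  have m: "{\<omega>\<in>space M. X T \<omega> \<in> closure U} \<in> sets M" by measurable
  have "AE \<omega> in M. (\<exists>t\<in>{T..T}. X t \<omega> \<in> closure U) \<longrightarrow> (\<exists>t\<in>{T..T}. X t \<omega> \<in> interior U)"
    by (rule AE_upper_set_hits_interior[OF T_pos order_refl], rule up)
  then have "AE \<omega> in M. X T \<omega> \<in> U \<longleftrightarrow> X T \<omega> \<in> closure U"
    by eventually_elim (use closure_subset[of U] interior_subset[of U] in auto)
  from completion_AE_cong[OF sets_completionI_sets[OF m] this] m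
  show "{\<omega>\<in>space M. X T \<omega> \<in> U} \<in> sets (completion M)"
    and "measure (completion M) {\<omega>\<in>space M. X T \<omega> \<in> U} = prob {\<omega>\<in>space M. X T \<omega> \<in> closure U}" by auto
qed

end

lemma closure_upper_set:
  fixes U :: "(real^'n) set"
  assumes up: "\<And>x y. x \<in> U \<Longrightarrow> (\<And>i. x $ i \<le> y $ i) \<Longrightarrow> y \<in> U"
    and x: "x \<in> closure U" and k: "\<And>i. 0 \<le> k $ i"
  shows "x + k \<in> closure U"
proof -
  obtain f where f: "\<And>n. f n \<in> U" "f \<longlonglongrightarrow> x" using x unfolding closure_sequential by metis
  have "f n + k \<in> U" for n using f(1)[of n] by (rule up) (simp add: k)
  moreover have "(\<lambda>n. f n + k) \<longlonglongrightarrow> x + k" using f(2) by (intro tendsto_intros)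
  ultimately show ?thesis unfolding closure_sequential by metis
qed

section \<open>Covariance of the terminal value; hitting bounds for cones and upper sets\<close>

context drifted_brownian_motion
begin

text \<open>The normal law is given for increments, so the moments are computed with
  \<open>B T - B 0\<close>, which almost surely equals \<open>B T\<close>. Its coordinates are
  centred and independent with variance \<open>T\<close>, so only the diagonal terms of the double
  sum survive.\<close>

lemma covariance_matrix_terminal:
  "covariance_matrix M (\<lambda>\<omega>. A *v B T \<omega>) = T *\<^sub>R (A ** transpose A)"
proof -
  define N where "N k \<omega> = (B T \<omega> - B 0 \<omega>) $ k" for k \<omega>
  have d: "distributed M lborel (N k) (normal_density 0 (sqrt T))" for k
    using increment_component_distributed[of 0 T k] T_pos by (simp add: N_def[abs_def])
  have Nm[measurable]: "N k \<in> borel_measurable M" for k using d[of k] by (simp add: distributed_def)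
  have iN: "integrable M (N k)" for k
    using distributed_integrable[OF d, of "\<lambda>x. x" k] integrable_normal_moment_nz_1[of "sqrt T" 0] T_pos by simp
  have iN2: "integrable M (\<lambda>\<omega>. N k \<omega> * N k \<omega>)" for k
    using distributed_integrable[OF d, of "\<lambda>x. x * x" k] integrable_normal_moment[of "sqrt T" 0 2] T_pos
    by (simp add: power2_eq_square)
  have E0: "expectation (N k) = 0" for k
    using normal_distributed_expectation[OF _ d] T_pos by simp
  have E2: "expectation (\<lambda>\<omega>. N k \<omega> * N k \<omega>) = T" for k
    using normal_distributed_variance[OF _ d, of k] T_pos by (simp add: E0 power2_eq_square)
  have ind: "indep_vars (\<lambda>_. borel) N UNIV"
    using indep_increment_components[of 0 T] T_pos by (simp add: N_def[abs_def])
  have iNN: "integrable M (\<lambda>\<omega>. N k \<omega> * N l \<omega>)"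
    and ENN: "expectation (\<lambda>\<omega>. N k \<omega> * N l \<omega>) = (if k = l then T else 0)" for k l
  proof -
    have "integrable M (\<lambda>\<omega>. N k \<omega> * N l \<omega>) \<and> expectation (\<lambda>\<omega>. N k \<omega> * N l \<omega>) = (if k = l then T else 0)"
    proof (cases "k = l")
      case True
      then show ?thesis using iN2 E2 by simp
    next
      case False
      have sub: "indep_vars (\<lambda>_. borel) N {k, l}" using ind by (rule indep_vars_subset) simp
      show ?thesis
        using False indep_vars_lebesgue_integral[OF _ sub iN] indep_vars_integrable[OF _ sub iN] by (simp add: E0)
    qed
    then show "integrable M (\<lambda>\<omega>. N k \<omega> * N l \<omega>)" "expectation (\<lambda>\<omega>. N k \<omega> * N l \<omega>) = (if k = l then T else 0)"
      by auto
  qed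
  define Z where "Z i \<omega> = (A *v B T \<omega>) $ i" for i \<omega>
  have [measurable]: "B T \<in> borel_measurable M" using T_pos by (intro B_measurable) auto
  have Zm[measurable]: "Z i \<in> borel_measurable M" for i unfolding Z_def[abs_def] by measurable
  have aeZ: "AE \<omega> in M. Z i \<omega> = (\<Sum>k\<in>UNIV. A $ i $ k * N k \<omega>)" for i
    using AE_start by eventually_elim (simp add: Z_def N_def matrix_vector_mult_def)
  have EZ: "expectation (Z i) = 0" for i
  proof -
    have "expectation (Z i) = expectation (\<lambda>\<omega>. \<Sum>k\<in>UNIV. A $ i $ k * N k \<omega>)"
      by (rule integral_cong_AE) (use aeZ in auto)
    also have "\<dots> = 0" using iN E0 by (subst Bochner_Integration.integral_sum) auto
    finally show ?thesis .
  qed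
  have "expectation (\<lambda>\<omega>. Z i \<omega> * Z j \<omega>) = (T *\<^sub>R (A ** transpose A)) $ i $ j" for i j
  proof -
    have "AE \<omega> in M. Z i \<omega> * Z j \<omega> = (\<Sum>k\<in>UNIV. \<Sum>l\<in>UNIV. A $ i $ k * A $ j $ l * (N k \<omega> * N l \<omega>))"
      using aeZ[of i] aeZ[of j] by eventually_elim (simp add: sum_product algebra_simps)
    then have "expectation (\<lambda>\<omega>. Z i \<omega> * Z j \<omega>)
       = expectation (\<lambda>\<omega>. \<Sum>k\<in>UNIV. \<Sum>l\<in>UNIV. A $ i $ k * A $ j $ l * (N k \<omega> * N l \<omega>))"
      by (intro integral_cong_AE) auto
    also have "\<dots> = (\<Sum>k\<in>UNIV. \<Sum>l\<in>UNIV. A $ i $ k * A $ j $ l * (if k = l then T else 0))"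
      using iNN ENN by (simp add: Bochner_Integration.integral_sum)
    also have "\<dots> = (\<Sum>k\<in>UNIV. A $ i $ k * A $ j $ k * T)"
      by (intro sum.cong refl) (simp add: if_distrib[of "\<lambda>x. _ * x"] cong: if_cong)
    also have "\<dots> = (T *\<^sub>R (A ** transpose A)) $ i $ j"
      by (simp add: matrix_matrix_mult_def transpose_def sum_distrib_left algebra_simps)
    finally show ?thesis .
  qed
  then show ?thesis
    unfolding covariance_matrix_def Z_def[symmetric] EZ by (simp add: vec_eq_iff)
qed

text \<open>Supplies the \<open>\<kappa>\<close> of \<open>closed_hitting_bound\<close>: an
  increment in \<open>K\<close> keeps \<open>x\<close> inside \<open>Q\<close>, and
  \<open>cone_prob_ge\<close> bounds the probability of such an increment below, uniformly in the
  starting time.\<close>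

lemma cone_hitting_bound:
  assumes Q: "closed Q"
    and C: "0 \<le> C" "\<And>s. 0 \<le> s \<Longrightarrow> s < T \<Longrightarrow>
      C \<le> exp (- (norm (matrix_inv A *v ((c T - c s) /\<^sub>R sqrt (T - s))))\<^sup>2)"
    and \<epsilon>: "0 \<le> \<epsilon>"
    and cone: "\<And>x. x \<in> Q \<Longrightarrow> \<exists>K\<in>sets borel. (+) x ` K \<subseteq> Q \<and> (\<forall>C>1. K \<subseteq> (\<lambda>w. C *\<^sub>R w) ` K) \<and>
      \<epsilon> \<le> prob {\<omega>\<in>space M. A *v (B T \<omega> - B 0 \<omega>) \<in> K}"
  shows "C * \<epsilon> / 2 powr (real CARD('n) / 2) * measure (completion M) {\<omega>\<in>space M. \<exists>t\<in>{0..T}. X t \<omega> \<in> Q}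
    \<le> prob {\<omega>\<in>space M. X T \<omega> \<in> Q}"
proof (rule closed_hitting_bound[OF Q])
  let ?d = "2 powr (real CARD('n) / 2)"
  show "0 \<le> C * \<epsilon> / ?d" using C(1) \<epsilon> by simp
  fix x s assume x: "x \<in> Q" and s: "0 \<le> s" "s \<le> T"
  obtain K where K: "K \<in> sets borel" "(+) x ` K \<subseteq> Q" "\<And>C. C > 1 \<Longrightarrow> K \<subseteq> (\<lambda>w. C *\<^sub>R w) ` K"
    "\<epsilon> \<le> prob {\<omega>\<in>space M. A *v (B T \<omega> - B 0 \<omega>) \<in> K}"
    using cone[OF x] by blast
  show "C * \<epsilon> / ?d \<le> prob {\<omega>\<in>space M. x + (A *v (B T \<omega> - B s \<omega>) - (c T - c s)) \<in> Q}"
  proof (cases "s = T")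
    case True
    have "C \<le> 1" using C(2)[OF order_refl T_pos] by (rule order_trans) simp
    moreover have "\<epsilon> \<le> 1" using K(4) prob_le_1 by (rule order_trans)
    moreover have "1 \<le> ?d" by (simp add: ge_one_powr_ge_zero)
    ultimately have "C * \<epsilon> / ?d \<le> 1"
      using C(1) \<epsilon> mult_mono[of C 1 \<epsilon> 1] by (simp add: divide_le_eq)
    also have "{\<omega>\<in>space M. x + (A *v (B T \<omega> - B s \<omega>) - (c T - c s)) \<in> Q} = space M"
      using x True by auto
    then have "1 = prob {\<omega>\<in>space M. x + (A *v (B T \<omega> - B s \<omega>) - (c T - c s)) \<in> Q}"
      by (simp add: prob_space)
    finally show ?thesis .
  next
    case False
    then have sT: "s < T" using s by simp
    have [measurable]: "(\<lambda>\<omega>. B T \<omega> - B s \<omega>) \<in> borel_measurable M"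
      using s T_pos by (intro increment_measurable) auto
    have [measurable]: "Q \<in> sets borel" using Q by simp
    have "C * \<epsilon> / ?d \<le> exp (- (norm (matrix_inv A *v ((c T - c s) /\<^sub>R sqrt (T - s))))\<^sup>2) / ?d
         * prob {\<omega>\<in>space M. A *v (B T \<omega> - B 0 \<omega>) \<in> K}"
      using mult_mono[OF C(2)[OF s(1) sT] K(4)] \<epsilon> by (simp add: divide_right_mono)
    also have "\<dots> \<le> prob {\<omega>\<in>space M. A *v (B T \<omega> - B s \<omega>) - (c T - c s) \<in> K}"
      by (rule cone_prob_ge[OF s(1) sT K(1) K(3)])
    also have "\<dots> \<le> prob {\<omega>\<in>space M. x + (A *v (B T \<omega> - B s \<omega>) - (c T - c s)) \<in> Q}"
    proof (rule finite_measure_mono)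
      show "{\<omega>\<in>space M. A *v (B T \<omega> - B s \<omega>) - (c T - c s) \<in> K}
        \<subseteq> {\<omega>\<in>space M. x + (A *v (B T \<omega> - B s \<omega>) - (c T - c s)) \<in> Q}"
        using K(2) by (auto simp del: add_diff_eq)
    qed measurable
    finally show ?thesis .
  qed
qed

text \<open>The preimage of the open orthant under \<open>A\<close> is open, and it contains
  \<open>matrix_inv A\<close> applied to the all-ones vector.\<close>

lemma orthant_prob_pos:
  "0 < prob {\<omega>\<in>space M. A *v (B T \<omega> - B 0 \<omega>) \<in> {x. \<forall>i. 0 \<le> x $ i}}"
proof -
  have [measurable]: "(\<lambda>\<omega>. B T \<omega> - B 0 \<omega>) \<in> borel_measurable M"
    using T_pos by (intro increment_measurable) auto
  let ?U = "(\<lambda>y. A *v y) -` {x. \<forall>i. 0 < x $ i}"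
  have "?U = (\<Inter>i. {y. 0 < (A *v y) $ i})" by auto
  moreover have "open {y. 0 < (A *v y) $ i}" for i
    by (intro open_Collect_less continuous_intros linear_continuous_on matrix_vector_mul_bounded_linear)
  ultimately have "open ?U" by (simp add: open_INT)
  moreover have "matrix_inv A *v (\<chi> i. 1) \<in> ?U" by (simp add: matrix_inv_vector_mult(1)[OF inv_A])
  ultimately have "0 < prob {\<omega>\<in>space M. B T \<omega> - B 0 \<omega> \<in> ?U}"
    using T_pos by (intro increment_open_prob_pos) auto
  also have "\<dots> \<le> prob {\<omega>\<in>space M. A *v (B T \<omega> - B 0 \<omega>) \<in> {x. \<forall>i. 0 \<le> x $ i}}"
    by (rule finite_measure_mono) (auto intro: less_imp_le)
  finally show ?thesis .
qed

text \<open>Passing to \<open>closure U\<close> enlarges the hitting event and gives a closed set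
  into which the orthant can be translated at every point. At the terminal time the closure costs
  nothing, by \<open>upper_set_terminal\<close>.\<close>

lemma upper_set_hitting_bound:
  fixes U :: "(real^'n) set"
  assumes up: "\<And>x y. x \<in> U \<Longrightarrow> (\<And>i. x $ i \<le> y $ i) \<Longrightarrow> y \<in> U"
    and C: "0 \<le> C" "\<And>s. 0 \<le> s \<Longrightarrow> s < T \<Longrightarrow>
      C \<le> exp (- (norm (matrix_inv A *v ((c T - c s) /\<^sub>R sqrt (T - s))))\<^sup>2)"
  shows "C * prob {\<omega>\<in>space M. A *v (B T \<omega> - B 0 \<omega>) \<in> {x. \<forall>i. 0 \<le> x $ i}} / 2 powr (real CARD('n) / 2)
     * measure (completion M) {\<omega>\<in>space M. \<exists>t\<in>{0..T}. X t \<omega> \<in> U}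
    \<le> measure (completion M) {\<omega>\<in>space M. X T \<omega> \<in> U}"
proof -
  interpret compl: prob_space "completion M"
    by (rule prob_spaceI) (simp add: emeasure_space_1)
  let ?K = "{x :: real^'n. \<forall>i. 0 \<le> x $ i}"
  let ?e = "prob {\<omega>\<in>space M. A *v (B T \<omega> - B 0 \<omega>) \<in> ?K}"
  let ?d = "2 powr (real CARD('n) / 2)"
  have "measure (completion M) {\<omega>\<in>space M. \<exists>t\<in>{0..T}. X t \<omega> \<in> U}
      \<le> measure (completion M) {\<omega>\<in>space M. \<exists>t\<in>{0..T}. X t \<omega> \<in> closure U}"
    using closure_subset[of U] by (intro compl.finite_measure_mono closed_hitting_sets) auto
  then have "C * ?e / ?d * measure (completion M) {\<omega>\<in>space M. \<exists>t\<in>{0..T}. X t \<omega> \<in> U}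
      \<le> C * ?e / ?d * measure (completion M) {\<omega>\<in>space M. \<exists>t\<in>{0..T}. X t \<omega> \<in> closure U}"
    using C(1) by (intro mult_left_mono) auto
  also have "\<dots> \<le> prob {\<omega>\<in>space M. X T \<omega> \<in> closure U}"
  proof (rule cone_hitting_bound[OF closed_closure C])
    fix x assume x: "x \<in> closure U"
    have "closed ?K" by (intro closed_Collect_all closed_Collect_le continuous_intros)
    then have "?K \<in> sets borel" by simp
    moreover have "(+) x ` ?K \<subseteq> closure U"
    proof
      fix y assume "y \<in> (+) x ` ?K"
      then obtain k where k: "y = x + k" "\<And>i. 0 \<le> k $ i" by auto
      show "y \<in> closure U" unfolding k(1) by (rule closure_upper_set[OF _ x k(2)], rule up)
    qed
    moreover have "?K \<subseteq> (\<lambda>w. C *\<^sub>R w) ` ?K" if "C > 1" for C :: real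
    proof
      fix k assume "k \<in> ?K"
      then show "k \<in> (\<lambda>w. C *\<^sub>R w) ` ?K"
        using that by (intro image_eqI[of _ _ "(1 / C) *\<^sub>R k"]) auto
    qed
    ultimately show "\<exists>K\<in>sets borel. (+) x ` K \<subseteq> closure U \<and> (\<forall>C>1. K \<subseteq> (\<lambda>w. C *\<^sub>R w) ` K) \<and>
      ?e \<le> prob {\<omega>\<in>space M. A *v (B T \<omega> - B 0 \<omega>) \<in> K}"
      by (intro bexI[of _ ?K]) auto
  qed (assumption | rule measure_nonneg)+
  also have "\<dots> = measure (completion M) {\<omega>\<in>space M. X T \<omega> \<in> U}"
    by (rule upper_set_terminal(2)[symmetric], rule up)
  finally show ?thesis .
qed

end

text \<open>\<open>Pr\<close> lives on the completion because hitting events range over uncountably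
  many times and the sets defined by \<open>F\<close> need not be Borel. The membership claims guard
  against the default value 0 of \<open>measure\<close> outside the sigma-algebra.\<close>

theorem theorem1p3:
  fixes M :: "'w measure"
    and A \<Sigma> :: "real ^ 'n ^ 'n"
    and B Z :: "real \<Rightarrow> 'w \<Rightarrow> real ^ 'n"
    and c :: "real \<Rightarrow> real ^ 'n"
    and T \<CC> :: real
    and Pr :: "'w set \<Rightarrow> real"
  assumes "invertible A"
    and "vector_brownian_motion M B"
    and "\<And>t \<omega>. Z t \<omega> = A *v B t \<omega>"
    and "T > 0"
    and "c \<in> RV T T (1/2)"
    and "\<Sigma> = covariance_matrix M (Z T)"
    and "\<CC> = (INF t\<in>{0..<T}.
           exp (- T * (((c T - c t) /\<^sub>R sqrt (T - t)) \<bullet>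
                        (matrix_inv \<Sigma> *v ((c T - c t) /\<^sub>R sqrt (T - t))))))"
    and "Pr = measure (completion M)"
  shows "\<CC> > 0 \<and>
         (\<forall>S \<epsilon>. closed S \<and> 0 \<notin> S \<and> cone_condition_with M Z S \<epsilon> \<longrightarrow>
           (\<forall>u>1.
              {\<omega> \<in> space M. \<exists>t\<in>{0..T}. Z t \<omega> - c t \<in> (\<lambda>x. u *\<^sub>R x) ` S} \<in> sets (completion M) \<and>
              Pr {\<omega> \<in> space M. Z T \<omega> - c T \<in> (\<lambda>x. u *\<^sub>R x) ` S}
                \<le> Pr {\<omega> \<in> space M. \<exists>t\<in>{0..T}. Z t \<omega> - c t \<in> (\<lambda>x. u *\<^sub>R x) ` S} \<and>
              Pr {\<omega> \<in> space M. \<exists>t\<in>{0..T}. Z t \<omega> - c t \<in> (\<lambda>x. u *\<^sub>R x) ` S}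
                \<le> 2 powr (real CARD('n) / 2) / (\<CC> * \<epsilon> T) *
                    Pr {\<omega> \<in> space M. Z T \<omega> - c T \<in> (\<lambda>x. u *\<^sub>R x) ` S})) \<and>
         (\<forall>F a. growing F \<and> a \<notin> {x. \<forall>i. x $ i \<le> 0} \<longrightarrow>
           (\<exists>C\<^sub>T :: real. \<forall>u>1.
              {\<omega> \<in> space M. \<exists>t\<in>{0..T}. comp_greater (F (Z t \<omega> - c t)) (u *\<^sub>R a)} \<in> sets (completion M) \<and>
              {\<omega> \<in> space M. comp_greater (F (Z T \<omega> - c T)) (u *\<^sub>R a)} \<in> sets (completion M) \<and>
              Pr {\<omega> \<in> space M. \<exists>t\<in>{0..T}. comp_greater (F (Z t \<omega> - c t)) (u *\<^sub>R a)}
                \<le> C\<^sub>T * Pr {\<omega> \<in> space M. comp_greater (F (Z T \<omega> - c T)) (u *\<^sub>R a)}))"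
proof -
  have Z: "Z t = (\<lambda>\<omega>. A *v B t \<omega>)" for t using assms(3) by auto
  obtain L where c_cont: "continuous_on {0..} c" and L: "L > 0"
    and c_bound: "\<And>i t. t \<in> {0..T} \<Longrightarrow> \<bar>c t $ i - c T $ i\<bar> \<le> L * \<bar>t - T\<bar> powr (1/2)"
    using assms(5) unfolding RV_def by blast
  interpret vector_brownian_motion M B by fact
  interpret drifted_brownian_motion M B A c T
    by unfold_locales (use assms c_cont in auto)
  interpret compl: prob_space "completion M"
    by (rule prob_spaceI) (simp add: emeasure_space_1)
  define w where "w t = (c T - c t) /\<^sub>R sqrt (T - t)" for t
  have \<Sigma>: "\<Sigma> = T *\<^sub>R (A ** transpose A)"
    unfolding assms(6) Z by (rule covariance_matrix_terminal)
  have \<CC>: "\<CC> = (INF t\<in>{0..<T}. exp (- (norm (matrix_inv A *v w t))\<^sup>2))"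
    unfolding assms(7) \<Sigma> w_def[symmetric]
    by (simp only: mult_minus_left inner_matrix_inv_mult_transpose[OF assms(1,4)])
  have \<CC>_le: "\<CC> \<le> exp (- (norm (matrix_inv A *v ((c T - c s) /\<^sub>R sqrt (T - s))))\<^sup>2)" if "0 \<le> s" "s < T" for s
    unfolding \<CC> w_def[symmetric] using that by (intro cINF_lower bdd_belowI[of _ 0]) auto
  have \<CC>_pos: "0 < \<CC>"
  proof -
    obtain N where N: "\<And>x. norm (matrix_inv A *v x) \<le> norm x * N" "0 < N"
      using bounded_linear.pos_bounded[OF matrix_vector_mul_bounded_linear[of "matrix_inv A"]] by blast
    \<comment> \<open>The exponent 1/2 in \<open>RV\<close> cancels \<open>sqrt (T - t)\<close>, so
      each coordinate of \<open>w t\<close> is at most \<open>L\<close> in absolute value. The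
      resulting bound does not depend on \<open>t\<close> and keeps the infimum away from 0.\<close>
    have "norm (matrix_inv A *v w t) \<le> real CARD('n) * L * N" if t: "t \<in> {0..<T}" for t
    proof -
      have "\<bar>w t $ i\<bar> \<le> L" for i
      proof -
        have "\<bar>c T $ i - c t $ i\<bar> \<le> L * sqrt (T - t)"
          using c_bound[of t i] t by (simp add: abs_minus_commute powr_half_sqrt)
        then show ?thesis using t by (simp add: w_def abs_mult field_simps)
      qed
      then have "norm (w t) \<le> (\<Sum>i\<in>(UNIV::'n set). L)"
        by (intro order_trans[OF norm_le_l1_cart] sum_mono)
      then have "norm (w t) * N \<le> real CARD('n) * L * N" using N by (intro mult_right_mono) auto
      with N(1) show ?thesis by (rule order_trans)
    qed
    then have "exp (- (real CARD('n) * L * N)\<^sup>2) \<le> \<CC>"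
      unfolding \<CC> using assms(4) by (intro cINF_greatest) (auto intro!: power_mono)
    then show ?thesis by (rule less_le_trans[rotated]) simp
  qed
  have hit: "AE \<omega> in M. (\<exists>t\<in>{0..T}. P (Z t \<omega> - c t)) \<longleftrightarrow> (\<exists>t\<in>{0..T}. P (X t \<omega>))"
    and final: "AE \<omega> in M. P (Z T \<omega> - c T) \<longleftrightarrow> P (X T \<omega>)" for P
    using AE_eq_X by (eventually_elim, simp add: assms(3))+
  have [measurable]: "X T \<in> borel_measurable M" using T_pos by (intro X_measurable) auto
  have [measurable]: "(\<lambda>\<omega>. B T \<omega> - B 0 \<omega>) \<in> borel_measurable M"
    using T_pos by (intro increment_measurable) auto
  let ?d = "2 powr (real CARD('n) / 2)"
  have part1: "{\<omega> \<in> space M. \<exists>t\<in>{0..T}. Z t \<omega> - c t \<in> (\<lambda>x. u *\<^sub>R x) ` S} \<in> sets (completion M) \<and>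
      Pr {\<omega> \<in> space M. Z T \<omega> - c T \<in> (\<lambda>x. u *\<^sub>R x) ` S}
        \<le> Pr {\<omega> \<in> space M. \<exists>t\<in>{0..T}. Z t \<omega> - c t \<in> (\<lambda>x. u *\<^sub>R x) ` S} \<and>
      Pr {\<omega> \<in> space M. \<exists>t\<in>{0..T}. Z t \<omega> - c t \<in> (\<lambda>x. u *\<^sub>R x) ` S}
        \<le> ?d / (\<CC> * \<epsilon> T) * Pr {\<omega> \<in> space M. Z T \<omega> - c T \<in> (\<lambda>x. u *\<^sub>R x) ` S}"
    if S: "closed S" and cc: "cone_condition_with M Z S \<epsilon>" and u: "u > 1" for S \<epsilon> u
  proof -
    define Q where "Q = (\<lambda>x. u *\<^sub>R x) ` S"
    have Q: "closed Q" unfolding Q_def using S by (rule closed_scaling)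
    then have [measurable]: "Q \<in> sets borel" by simp
    have \<epsilon>: "0 < \<epsilon> T" using cc T_pos by (auto simp: cone_condition_with_def)
    have hs: "{\<omega>\<in>space M. \<exists>t\<in>{0..T}. Z t \<omega> - c t \<in> Q} \<in> sets (completion M)"
      and he: "Pr {\<omega>\<in>space M. \<exists>t\<in>{0..T}. Z t \<omega> - c t \<in> Q} = Pr {\<omega>\<in>space M. \<exists>t\<in>{0..T}. X t \<omega> \<in> Q}"
      using completion_AE_cong[OF closed_hitting_sets[OF Q] hit[of "\<lambda>x. x \<in> Q"]] assms(8) by auto
    have "{\<omega>\<in>space M. X T \<omega> \<in> Q} \<in> sets M" by measurable
    then have fe: "Pr {\<omega>\<in>space M. Z T \<omega> - c T \<in> Q} = prob {\<omega>\<in>space M. X T \<omega> \<in> Q}"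
      using completion_AE_cong(2)[OF _ final[of "\<lambda>x. x \<in> Q"]] assms(8) by simp
    have le1: "Pr {\<omega>\<in>space M. Z T \<omega> - c T \<in> Q} \<le> Pr {\<omega>\<in>space M. \<exists>t\<in>{0..T}. Z t \<omega> - c t \<in> Q}"
      unfolding assms(8) using hs T_pos by (intro compl.finite_measure_mono) auto
    have "\<CC> * \<epsilon> T / ?d * measure (completion M) {\<omega>\<in>space M. \<exists>t\<in>{0..T}. X t \<omega> \<in> Q} \<le> prob {\<omega>\<in>space M. X T \<omega> \<in> Q}"
    proof (rule cone_hitting_bound[OF Q _ \<CC>_le])
      fix x assume "x \<in> Q"
      then obtain x0 where x0: "x0 \<in> S" "x = u *\<^sub>R x0" by (auto simp: Q_def)
      then obtain V where V[measurable]: "V \<in> sets borel" and VS: "V \<subseteq> S"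
        and Vc: "\<And>C. C > 1 \<Longrightarrow> (\<lambda>v. v - x0) ` V \<subseteq> (\<lambda>w. C *\<^sub>R w) ` (\<lambda>v. v - x0) ` V"
        and Vp: "\<And>t. t > 0 \<Longrightarrow> measure M {\<omega> \<in> space M. Z t \<omega> \<in> (\<lambda>v. v - x0) ` V} \<ge> \<epsilon> t"
        using cc unfolding cone_condition_with_def by blast
      define W where "W = (\<lambda>v. v - x0) ` V"
      have W: "W = (\<lambda>x. x + x0) -` V" by (force simp: W_def)
      have Wm[measurable]: "W \<in> sets borel"
        unfolding W using measurable_sets[of "\<lambda>x. x + x0" borel borel V] by simp
      \<comment> \<open>\<open>W\<close> is the cone at \<open>x0\<close>; scaled by
        \<open>u\<close> it becomes a cone \<open>K\<close> whose translate to
        \<open>x = u *\<^sub>R x0\<close> lies in \<open>Q\<close>.\<close>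
      define K where "K = (\<lambda>w. u *\<^sub>R w) ` W"
      have K: "K = (\<lambda>x. x /\<^sub>R u) -` W" using u by (force simp: K_def image_iff)
      have Km[measurable]: "K \<in> sets borel"
        unfolding K using measurable_sets[of "\<lambda>x. x /\<^sub>R u" borel borel W] by simp
      have "(+) x ` K \<subseteq> Q"
        using VS by (auto simp: K_def W_def Q_def x0 scaleR_right_diff_distrib)
      moreover have "K \<subseteq> (\<lambda>w. C *\<^sub>R w) ` K" if "C > 1" for C
      proof
        fix k assume "k \<in> K"
        then obtain y where y: "y \<in> W" "k = u *\<^sub>R y" by (auto simp: K_def)
        with Vc[OF that] obtain y' where "y' \<in> W" "y = C *\<^sub>R y'" unfolding W_def by blast
        with y have "k = C *\<^sub>R (u *\<^sub>R y')" "u *\<^sub>R y' \<in> K" by (auto simp: K_def)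
        then show "k \<in> (\<lambda>w. C *\<^sub>R w) ` K" by blast
      qed
      moreover have "\<epsilon> T \<le> prob {\<omega>\<in>space M. A *v (B T \<omega> - B 0 \<omega>) \<in> K}"
      proof -
        have [measurable]: "B T \<in> borel_measurable M" using T_pos by (intro B_measurable) auto
        have "\<epsilon> T \<le> prob {\<omega>\<in>space M. Z T \<omega> \<in> W}" using Vp[OF T_pos] by (simp add: W_def)
        also have "\<dots> = prob {\<omega>\<in>space M. A *v (B T \<omega> - B 0 \<omega>) \<in> W}"
          using AE_start unfolding Z by (intro measure_eq_AE) (auto elim!: eventually_mono)
        \<comment> \<open>Here \<open>u > 1\<close> enters: the cone property with factor
          \<open>u\<close> says \<open>W \<subseteq> K\<close>, so the bound
          \<open>\<epsilon> T\<close> serves for every such \<open>u\<close>.\<close>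
        also have "\<dots> \<le> prob {\<omega>\<in>space M. A *v (B T \<omega> - B 0 \<omega>) \<in> K}"
          using Vc[OF u] unfolding W_def[symmetric] K_def[symmetric] by (intro finite_measure_mono) auto
        finally show ?thesis .
      qed
      ultimately show "\<exists>K\<in>sets borel. (+) x ` K \<subseteq> Q \<and> (\<forall>C>1. K \<subseteq> (\<lambda>w. C *\<^sub>R w) ` K) \<and>
          \<epsilon> T \<le> prob {\<omega>\<in>space M. A *v (B T \<omega> - B 0 \<omega>) \<in> K}"
        using Km by blast
    qed (use \<CC>_pos \<epsilon> in auto)
    then have "Pr {\<omega>\<in>space M. \<exists>t\<in>{0..T}. Z t \<omega> - c t \<in> Q}
        \<le> ?d / (\<CC> * \<epsilon> T) * Pr {\<omega>\<in>space M. Z T \<omega> - c T \<in> Q}"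
      unfolding he fe unfolding assms(8) using \<CC>_pos \<epsilon> by (simp add: field_simps)
    with hs le1 show ?thesis by (simp add: Q_def)
  qed
  have part2: "\<exists>C\<^sub>T :: real. \<forall>u>1.
      {\<omega> \<in> space M. \<exists>t\<in>{0..T}. comp_greater (F (Z t \<omega> - c t)) (u *\<^sub>R a)} \<in> sets (completion M) \<and>
      {\<omega> \<in> space M. comp_greater (F (Z T \<omega> - c T)) (u *\<^sub>R a)} \<in> sets (completion M) \<and>
      Pr {\<omega> \<in> space M. \<exists>t\<in>{0..T}. comp_greater (F (Z t \<omega> - c t)) (u *\<^sub>R a)}
        \<le> C\<^sub>T * Pr {\<omega> \<in> space M. comp_greater (F (Z T \<omega> - c T)) (u *\<^sub>R a)}"
    if F: "growing F" for F and a :: "real^'n"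
  proof -
    let ?e = "prob {\<omega>\<in>space M. A *v (B T \<omega> - B 0 \<omega>) \<in> {x. \<forall>i. 0 \<le> x $ i}}"
    show ?thesis
    \<comment> \<open>The probability \<open>?e\<close> of the orthant plays the part of
      \<open>\<epsilon> T\<close>; neither it nor \<open>\<CC>\<close> involves
      \<open>u\<close>.\<close>
    proof (intro exI[of _ "?d / (\<CC> * ?e)"] allI impI)
      fix u :: real
      define U where "U = {x. comp_greater (F x) (u *\<^sub>R a)}"
      have up: "y \<in> U" if "x \<in> U" "\<And>i. x $ i \<le> y $ i" for x y
        using F that unfolding U_def growing_def comp_greater_def mem_Collect_eq
        by (meson less_le_trans)
      have hs: "{\<omega>\<in>space M. \<exists>t\<in>{0..T}. X t \<omega> \<in> U} \<in> sets (completion M)"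
        by (rule upper_set_hitting_sets, rule up)
      have fs: "{\<omega>\<in>space M. X T \<omega> \<in> U} \<in> sets (completion M)"
        by (rule upper_set_terminal(1), rule up)
      have bound: "\<CC> * ?e / ?d * measure (completion M) {\<omega>\<in>space M. \<exists>t\<in>{0..T}. X t \<omega> \<in> U}
          \<le> measure (completion M) {\<omega>\<in>space M. X T \<omega> \<in> U}"
        by (rule upper_set_hitting_bound[OF _ less_imp_le[OF \<CC>_pos] \<CC>_le], rule up)
      note h = completion_AE_cong[OF hs hit[of "\<lambda>x. x \<in> U"]]
      note f = completion_AE_cong[OF fs final[of "\<lambda>x. x \<in> U"]]
      have "Pr {\<omega>\<in>space M. \<exists>t\<in>{0..T}. Z t \<omega> - c t \<in> U}
          \<le> ?d / (\<CC> * ?e) * Pr {\<omega>\<in>space M. Z T \<omega> - c T \<in> U}"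
        unfolding assms(8) h(2) f(2) using bound \<CC>_pos orthant_prob_pos by (simp add: field_simps)
      with h(1) f(1) show "{\<omega> \<in> space M. \<exists>t\<in>{0..T}. comp_greater (F (Z t \<omega> - c t)) (u *\<^sub>R a)} \<in> sets (completion M) \<and>
          {\<omega> \<in> space M. comp_greater (F (Z T \<omega> - c T)) (u *\<^sub>R a)} \<in> sets (completion M) \<and>
          Pr {\<omega> \<in> space M. \<exists>t\<in>{0..T}. comp_greater (F (Z t \<omega> - c t)) (u *\<^sub>R a)}
            \<le> ?d / (\<CC> * ?e) * Pr {\<omega> \<in> space M. comp_greater (F (Z T \<omega> - c T)) (u *\<^sub>R a)}"
        by (simp add: U_def)
    qed
  qed
  show ?thesis using \<CC>_pos part1 part2 by blast
qed

end
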